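(* Let $(X,d,G)$ be a $G$-system with $\underline{\mathrm{mdim}}_M(G,X,d)<\infty$, and let $\{F_n\}$ be a tempered Følner sequence of $G$. If $$\underline{\mathrm{mdim}}_M(G,X,f,d)=\max_{\mu\in M(X,G)}\Big\{\underline{\mathrm{mdim}}_M(\mu,\{F_n\},d)+\int f\,d\mu\Big\}\quad\text{for all }f\in C(X,\mathbb R),$$ then for every $\mu_0\in M(X,G)$, $$\underline{\mathrm{mdim}}_M(\mu_0,\{F_n\},d)=\inf_{f\in C(X,\mathbb R)}\Big\{\underline{\mathrm{mdim}}_M(G,X,f,d)-\int f\,d\mu_0\Big\}.$$
   Context: $G$ is a countably infinite discrete amenable group; $(X,d,G)$ a compact metric space with continuous $G$-action by homeomorphisms. Følner: nonempty finite $F_n$ with $|gF_n\triangle F_n|/|F_n|\to0$; tempered: $|\bigcup_{j<n}F_j^{-1}F_n|\le C|F_n|$. $d_F(x,y)=\max_{g\in F}d(gx,gy)$, $S_Ff(x)=\sum_{g\in F}f(gx)$, $P_F(X,f,d,\epsilon)=\sup\{\sum_{x\in E}e^{S_Ff(x)}:E\subset X$ with pairwise $d_F$-distances $>\epsilon\}$, $P(X,f,d,\{F_n\},\epsilon)=\limsup_n\frac1{|F_n|}\log P_{F_n}(X,f,d,\epsilon)$, $\underline{\mathrm{mdim}}_M(G,X,f,d)=\liminf_{\epsilon\to0}\frac{P(X,f\log(1/\epsilon),d,\{F_n\},\epsilon)}{\log(1/\epsilon)}$, $\underline{\mathrm{mdim}}_M(G,X,d)=\underline{\mathrm{mdim}}_M(G,X,0,d)$.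 $M(X,G)$: invariant Borel probability measures (weak* ); $E(X,G)$: ergodic; $\mathrm{co}(E(X,G))$: finite convex combinations $\mu=\sum_j\lambda_j\mu_j$ (unique, distinct ergodic $\mu_j$, $\lambda_j>0$). For ergodic $\nu$, $h_\nu(\epsilon)=\inf\{h_\nu(G,\alpha):\alpha$ finite Borel partition, $\mathrm{diam}(\alpha)\le\epsilon\}$ where $h_\nu(G,\alpha)=\lim_n\frac1{|F_n|}H_\nu(\bigvee_{g\in F_n}g^{-1}\alpha)$; $F(\mu,\epsilon)=\sum_j\lambda_jh_{\mu_j}(\epsilon)$. $M_G(\mu)$: families $(\mu_\epsilon)_{\epsilon>0}\subset\mathrm{co}(E(X,G))$ with $\mu_\epsilon\to\mu$ weak* as $\epsilon\to0$. $\underline{\mathrm{mdim}}_M(\mu,\{F_n\},d)=\sup_{(\mu_\epsilon)\in M_G(\mu)}\liminf_{\epsilon\to0}F(\mu_\epsilon,\epsilon)/\log\frac1\epsilon$. *)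

theory Defs
  imports "HOL-Probability.Probability"
begin

text \<open>The group G is written additively (class group_add, not necessarily commutative);
  the paper's product g h is g + h and g^{-1} is -g.  The G-system is a type 'x of class
  metric_space (d = dist) with compact UNIV, and T g is the homeomorphism x |-> g x.\<close>

definition is_action :: "('g::group_add \<Rightarrow> 'x::metric_space \<Rightarrow> 'x) \<Rightarrow> bool" where
  "is_action T \<longleftrightarrow> T 0 = id \<and> (\<forall>g h. T (g + h) = T g \<circ> T h) \<and> (\<forall>g. continuous_on UNIV (T g))"

definition Folner :: "(nat \<Rightarrow> 'g::group_add set) \<Rightarrow> bool" where
  "Folner F \<longleftrightarrow> (\<forall>n. finite (F n) \<and> F n \<noteq> {}) \<and>
     (\<forall>g. (\<lambda>n. real (card (((+) g ` F n - F n) \<union> (F n - (+) g ` F n))) / real (card (F n)))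
            \<longlonglongrightarrow> 0)"

definition tempered :: "(nat \<Rightarrow> 'g::group_add set) \<Rightarrow> bool" where
  "tempered F \<longleftrightarrow> Folner F \<and>
     (\<exists>C::real. \<forall>n. real (card (\<Union>j<n. {- a + b | a b. a \<in> F j \<and> b \<in> F n})) \<le> C * real (card (F n)))"

definition dF :: "('g \<Rightarrow> 'x::metric_space \<Rightarrow> 'x) \<Rightarrow> 'g set \<Rightarrow> 'x \<Rightarrow> 'x \<Rightarrow> real" where
  "dF T F x y = Max ((\<lambda>g. dist (T g x) (T g y)) ` F)"

definition SF :: "('g \<Rightarrow> 'x \<Rightarrow> 'x) \<Rightarrow> 'g set \<Rightarrow> ('x \<Rightarrow> real) \<Rightarrow> 'x \<Rightarrow> real" where
  "SF T F f x = (\<Sum>g\<in>F. f (T g x))"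

definition PF :: "('g \<Rightarrow> 'x::metric_space \<Rightarrow> 'x) \<Rightarrow> 'g set \<Rightarrow> ('x \<Rightarrow> real) \<Rightarrow> real \<Rightarrow> real" where
  "PF T F f eps = Sup {(\<Sum>x\<in>E. exp (SF T F f x)) | E. finite E \<and>
                        (\<forall>x\<in>E. \<forall>y\<in>E. x \<noteq> y \<longrightarrow> dF T F x y > eps)}"

definition Ptop :: "('g \<Rightarrow> 'x::metric_space \<Rightarrow> 'x) \<Rightarrow> (nat \<Rightarrow> 'g set) \<Rightarrow> ('x \<Rightarrow> real) \<Rightarrow> real \<Rightarrow> ereal" where
  "Ptop T F f eps = limsup (\<lambda>n. ereal (ln (PF T (F n) f eps) / real (card (F n))))"

definition mdim_top :: "('g \<Rightarrow> 'x::metric_space \<Rightarrow> 'x) \<Rightarrow> (nat \<Rightarrow> 'g set) \<Rightarrow> ('x \<Rightarrow> real) \<Rightarrow> ereal" where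
  "mdim_top T F f = Liminf (at_right 0)
      (\<lambda>eps. Ptop T F (\<lambda>x. f x * ln (1 / eps)) eps / ereal (ln (1 / eps)))"

definition invariant_measures :: "('g \<Rightarrow> 'x::metric_space \<Rightarrow> 'x) \<Rightarrow> 'x measure set" where
  "invariant_measures T = {\<mu>. prob_space \<mu> \<and> sets \<mu> = sets borel \<and> (\<forall>g. distr \<mu> borel (T g) = \<mu>)}"

definition ergodic_measures :: "('g \<Rightarrow> 'x::metric_space \<Rightarrow> 'x) \<Rightarrow> 'x measure set" where
  "ergodic_measures T = {\<mu>. \<mu> \<in> invariant_measures T \<and>
      (\<forall>A\<in>sets borel. (\<forall>g. T g -` A = A) \<longrightarrow> measure \<mu> A = 0 \<or> measure \<mu> A = 1)}"

definition fin_partition :: "'x::metric_space set set \<Rightarrow> bool" where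
  "fin_partition \<alpha> \<longleftrightarrow> finite \<alpha> \<and> \<alpha> \<subseteq> sets borel \<and> \<Union>\<alpha> = UNIV \<and> disjoint \<alpha>"

definition join_part :: "('g \<Rightarrow> 'x \<Rightarrow> 'x) \<Rightarrow> 'g set \<Rightarrow> 'x set set \<Rightarrow> 'x set set" where
  "join_part T F \<alpha> = {(\<Inter>g\<in>F. T g -` c g) | c. \<forall>g\<in>F. c g \<in> \<alpha>} - {{}}"

definition part_entropy :: "'x measure \<Rightarrow> 'x set set \<Rightarrow> real" where
  "part_entropy \<nu> \<beta> = - (\<Sum>B\<in>\<beta>. (if measure \<nu> B = 0 then 0 else measure \<nu> B * ln (measure \<nu> B)))"

definition h_part :: "'x measure \<Rightarrow> ('g \<Rightarrow> 'x \<Rightarrow> 'x) \<Rightarrow> (nat \<Rightarrow> 'g set) \<Rightarrow> 'x set set \<Rightarrow> real" where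
  "h_part \<nu> T F \<alpha> = lim (\<lambda>n. part_entropy \<nu> (join_part T (F n) \<alpha>) / real (card (F n)))"

definition h_eps :: "'x::metric_space measure \<Rightarrow> ('g \<Rightarrow> 'x \<Rightarrow> 'x) \<Rightarrow> (nat \<Rightarrow> 'g set) \<Rightarrow> real \<Rightarrow> real" where
  "h_eps \<nu> T F eps = Inf {h_part \<nu> T F \<alpha> | \<alpha>. fin_partition \<alpha> \<and> (\<forall>A\<in>\<alpha>. diameter A \<le> eps)}"

definition mixture :: "('x::metric_space measure \<Rightarrow> real) \<Rightarrow> 'x measure" where
  "mixture w = measure_of UNIV (sets borel)
      (\<lambda>A. \<Sum>\<nu>\<in>{\<nu>. w \<nu> \<noteq> 0}. ennreal (w \<nu>) * emeasure \<nu> A)"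

definition co_rep :: "('g \<Rightarrow> 'x::metric_space \<Rightarrow> 'x) \<Rightarrow> 'x measure \<Rightarrow> ('x measure \<Rightarrow> real) \<Rightarrow> bool" where
  "co_rep T \<mu> w \<longleftrightarrow> finite {\<nu>. w \<nu> \<noteq> 0} \<and>
     (\<forall>\<nu>. w \<nu> \<noteq> 0 \<longrightarrow> w \<nu> > 0 \<and> \<nu> \<in> ergodic_measures T) \<and>
     (\<Sum>\<nu>\<in>{\<nu>. w \<nu> \<noteq> 0}. w \<nu>) = 1 \<and> \<mu> = mixture w"

definition coE :: "('g \<Rightarrow> 'x::metric_space \<Rightarrow> 'x) \<Rightarrow> 'x measure set" where
  "coE T = {\<mu>. \<exists>w. co_rep T \<mu> w}"

text \<open>F(mu,eps) via the (unique) representation of mu as a convex combination.\<close>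
definition Fmix :: "('g \<Rightarrow> 'x::metric_space \<Rightarrow> 'x) \<Rightarrow> (nat \<Rightarrow> 'g set) \<Rightarrow> 'x measure \<Rightarrow> real \<Rightarrow> real" where
  "Fmix T F \<mu> eps = (THE s. \<exists>w. co_rep T \<mu> w \<and> s = (\<Sum>\<nu>\<in>{\<nu>. w \<nu> \<noteq> 0}. w \<nu> * h_eps \<nu> T F eps))"

definition MG :: "('g \<Rightarrow> 'x::metric_space \<Rightarrow> 'x) \<Rightarrow> 'x measure \<Rightarrow> (real \<Rightarrow> 'x measure) set" where
  "MG T \<mu> = {\<mu>s. (\<forall>eps>0. \<mu>s eps \<in> coE T) \<and>
      (\<forall>f::'x \<Rightarrow> real. continuous_on UNIV f \<longrightarrow>
          ((\<lambda>eps. integral\<^sup>L (\<mu>s eps) f) \<longlongrightarrow> integral\<^sup>L \<mu> f) (at_right 0))}"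

definition mdim_meas :: "('g \<Rightarrow> 'x::metric_space \<Rightarrow> 'x) \<Rightarrow> (nat \<Rightarrow> 'g set) \<Rightarrow> 'x measure \<Rightarrow> ereal" where
  "mdim_meas T F \<mu> = (SUP \<mu>s\<in>MG T \<mu>.
      Liminf (at_right 0) (\<lambda>eps. ereal (Fmix T F (\<mu>s eps) eps / ln (1 / eps))))"

end

theory Submission
  imports Defs
begin

text \<open>One inequality is immediate from the variational principle. For the other, suppose that some
  real \<open>b\<close> lies strictly between \<open>mdim_meas T F \<mu>0\<close> and the infimum. For finitely many test functions
  \<open>\<phi>\<close> the pairs \<open>((\<integral>\<phi> d\<mu>)\<^sub>\<phi>, t)\<close>, with \<open>\<mu>\<close> a finite ergodic mixture whose normalised entropy at scale
  \<open>\<epsilon>\<close> is about \<open>t\<close> or more, form a convex set, because the entropy of a mixture is affine (distinct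
  ergodic measures are mutually singular, so the weights are unique). The variational principle for
  linear combinations of the test functions makes it impossible to separate \<open>((\<integral>\<phi> d\<mu>0)\<^sub>\<phi>, b)\<close> from
  this set. Hence mixtures close to \<open>\<mu>0\<close> with normalised entropy about \<open>b\<close> exist at every small
  scale, and a diagonal choice over countably many test functions gives a family in \<open>MG T \<mu>0\<close> showing
  \<open>b \<le> mdim_meas T F \<mu>0\<close>.\<close>

section \<open>Separation in finite dimensions and diagonal choice over scales\<close>

text \<open>A finite-dimensional separation argument without closest points: at a near-maximiser of
  \<open>t - N/2 * |v - v0|^2\<close> the first-order condition bounds the functional with coefficients
  \<open>- N * (v - v0)\<close>, and the support assumption for that functional forces
  \<open>b - \<delta> \<le> t - N * |v - v0|^2\<close>.\<close>

lemma penalised_maximisation: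
  fixes C :: "('i \<Rightarrow> real) \<Rightarrow> real \<Rightarrow> bool" and v0 B :: "'i \<Rightarrow> real"
  assumes fin: "finite I"
    and conv: "\<And>v t v' t' s. C v t \<Longrightarrow> C v' t' \<Longrightarrow> 0 \<le> s \<Longrightarrow> s \<le> 1 \<Longrightarrow>
        C (\<lambda>i. (1 - s) * v i + s * v' i) ((1 - s) * t + s * t')"
    and le_K: "\<And>v t. C v t \<Longrightarrow> t \<le> K"
    and bnd: "\<And>v t i. C v t \<Longrightarrow> i \<in> I \<Longrightarrow> \<bar>v i\<bar> \<le> B i"
    and supp: "\<And>a :: 'i \<Rightarrow> real. \<exists>v t. C v t \<and> b < t + (\<Sum>i\<in>I. a i * (v i - v0 i))"
    and "0 < \<delta>"
  shows "\<exists>v t. C v t \<and> b - \<delta> \<le> t \<and> (\<forall>i\<in>I. \<bar>v i - v0 i\<bar> \<le> \<delta>)"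
proof -
  obtain v1 t1 where c1: "C v1 t1" and "b < t1"
    using supp[of "\<lambda>_. 0"] by auto
  then have "b < K" using le_K[OF c1] by linarith
  \<comment> \<open>Calibrated for the end of the proof: the estimate
    \<open>N * q v < \<delta> + t - b\<close> together with \<open>t \<le> K\<close> then yields
    \<open>q v \<le> \<delta>\<^sup>2\<close>, hence closeness in every coordinate.\<close>
  define N where "N = (K - b + \<delta>) / \<delta>\<^sup>2"
  have N: "0 < N" "N * \<delta>\<^sup>2 = K - b + \<delta>"
    using \<open>b < K\<close> \<open>0 < \<delta>\<close> by (auto simp: N_def)
  define D where "D = (\<Sum>i\<in>I. (2 * B i)\<^sup>2)"
  have "0 \<le> D" unfolding D_def by (simp add: sum_nonneg)
  \<comment> \<open>Step length along the segment to a competitor. \<open>D\<close> bounds the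
    squared length of any such segment, so the second-order error \<open>N * D * s\<close> is at
    most \<delta>; the summand 1 keeps the denominator positive when \<open>D = 0\<close>.\<close>
  define s where "s = min 1 (\<delta> / (N * D + 1))"
  have ND: "0 \<le> N * D" using N \<open>0 \<le> D\<close> by simp
  have s: "0 < s" "s \<le> 1"
    using \<open>0 < \<delta>\<close> ND by (auto simp: s_def)
  have "N * D * s \<le> (N * D + 1) * (\<delta> / (N * D + 1))"
    using ND s by (intro mult_mono) (auto simp: s_def)
  then have sD: "N * D * s \<le> \<delta>" using ND by simp
  define q where "q v = (\<Sum>i\<in>I. (v i - v0 i)\<^sup>2)" for v
  define J where "J v t = t - N / 2 * q v" for v t
  define Js where "Js = {J v t | v t. C v t}"
  have q_nonneg: "0 \<le> q v" for v by (simp add: q_def sum_nonneg)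
  have bdd: "bdd_above Js"
  proof (rule bdd_aboveI)
    fix x assume "x \<in> Js"
    then obtain v t where "x = J v t" "C v t" by (auto simp: Js_def)
    moreover have "0 \<le> N / 2 * q v" using N q_nonneg by simp
    ultimately show "x \<le> K" using le_K[of v t] by (simp add: J_def)
  qed
  have "Js \<noteq> {}" using c1 by (auto simp: Js_def)
  \<comment> \<open>The supremum need not be attained. A defect proportional to \<open>s\<close> is
    harmless because the comparison is later divided by \<open>s\<close>.\<close>
  moreover have "Sup Js - s * \<delta> / 2 < Sup Js" using s \<open>0 < \<delta>\<close> by simp
  ultimately obtain x where "x \<in> Js" "Sup Js - s * \<delta> / 2 < x"
    using less_cSupE by metis
  then obtain v t where c: "C v t" and near: "Sup Js - s * \<delta> / 2 < J v t"
    by (auto simp: Js_def)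
  obtain v' t' where c': "C v' t'"
    and sup': "b < t' + (\<Sum>i\<in>I. (- N * (v i - v0 i)) * (v' i - v0 i))"
    using supp[of "\<lambda>i. - N * (v i - v0 i)"] by blast
  define x where "x = (\<Sum>i\<in>I. (v i - v0 i) * (v' i - v0 i))"
  define r where "r = (\<Sum>i\<in>I. (v' i - v i)\<^sup>2)"
  have b: "b < t' - N * x"
    using sup' by (simp add: x_def sum_distrib_left mult.assoc sum_negf)
  have "r \<le> D"
    unfolding r_def D_def
  proof (rule sum_mono)
    fix i assume "i \<in> I"
    then have "\<bar>v' i - v i\<bar> \<le> \<bar>2 * B i\<bar>"
      using bnd[OF c] bnd[OF c'] by fastforce
    then show "(v' i - v i)\<^sup>2 \<le> (2 * B i)\<^sup>2" by (simp only: abs_le_square_iff)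
  qed
  have "J (\<lambda>i. (1 - s) * v i + s * v' i) ((1 - s) * t + s * t') \<le> Sup Js"
    using conv[OF c c', of s] s by (intro cSup_upper bdd) (auto simp: Js_def)
  also have "\<dots> < J v t + s * \<delta> / 2" using near by simp
  finally have "J (\<lambda>i. (1 - s) * v i + s * v' i) ((1 - s) * t + s * t') < J v t + s * \<delta> / 2" .
  \<comment> \<open>The penalty is expanded exactly along the segment. After division by
    \<open>s\<close>, near-maximality costs \<open>\<delta> / 2\<close> and the quadratic remainder
    at most another \<open>\<delta> / 2\<close>.\<close>
  moreover have q_mix: "q (\<lambda>i. (1 - s) * v i + s * v' i) = q v + 2 * s * (x - q v) + s\<^sup>2 * r"
    unfolding q_def x_def r_def sum_subtractf[symmetric] sum_distrib_left sum.distrib[symmetric]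
    by (rule sum.cong) (auto simp: power2_eq_square algebra_simps)
  ultimately have "s * (t' - t - N * (x - q v)) < s * (\<delta> / 2 + N * r * s / 2)"
    by (simp only: J_def q_mix power2_eq_square) (simp add: field_simps)
  then have "t' - t - N * (x - q v) < \<delta> / 2 + N * r * s / 2"
    using s by simp
  also have "N * r * s \<le> N * D * s"
    using N s \<open>r \<le> D\<close> by (intro mult_right_mono mult_left_mono) auto
  finally have main: "b - t + N * q v < \<delta>"
    using b sD by (simp add: algebra_simps)
  have "0 \<le> N * q v" using N q_nonneg by simp
  with main have "b - \<delta> \<le> t" by linarith
  moreover have "\<bar>v i - v0 i\<bar> \<le> \<delta>" if "i \<in> I" for i
  proof -
    have "N * q v \<le> N * \<delta>\<^sup>2" using main le_K[OF c] N by linarith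
    then have "q v \<le> \<delta>\<^sup>2" using N(1) by (simp only: mult_le_cancel_left_pos)
    moreover have "(v i - v0 i)\<^sup>2 \<le> q v"
      unfolding q_def using fin that by (intro member_le_sum) auto
    ultimately have "(v i - v0 i)\<^sup>2 \<le> \<delta>\<^sup>2" by simp
    then show ?thesis using \<open>0 < \<delta>\<close> by (simp add: abs_le_square_iff[symmetric])
  qed
  ultimately show ?thesis using c by blast
qed

text \<open>At scale \<epsilon> the element is chosen for the largest index n with
  \<open>real n \<le> 1 / \<epsilon>\<close> and \<epsilon> below the threshold \<open>e n\<close>.
  The first condition keeps the set of indices finite. Both conditions hold for a fixed n once
  \<epsilon> is small, so the chosen index eventually dominates n, and \<open>anti\<close> passes
  the property down to n.\<close>

lemma diagonal_selection_at_right: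
  fixes P :: "nat \<Rightarrow> real \<Rightarrow> 'm \<Rightarrow> bool"
  assumes anti: "\<And>n k \<epsilon> m. P n \<epsilon> m \<Longrightarrow> k \<le> n \<Longrightarrow> P k \<epsilon> m"
    and ev: "\<And>n. \<forall>\<^sub>F \<epsilon> in at_right 0. \<exists>m. P n \<epsilon> m"
  shows "\<exists>s. \<forall>n. \<forall>\<^sub>F \<epsilon> in at_right 0. P n \<epsilon> (s \<epsilon>)"
proof -
  obtain e where e: "\<And>n. 0 < e n" "\<And>n \<epsilon>. 0 < \<epsilon> \<Longrightarrow> \<epsilon> < e n \<Longrightarrow> \<exists>m. P n \<epsilon> m"
    using ev unfolding eventually_at_right_field by metis
  define S where "S \<epsilon> = {n. real n \<le> 1 / \<epsilon> \<and> \<epsilon> < e n}" for \<epsilon>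
  have fin: "finite (S \<epsilon>)" for \<epsilon>
    by (rule finite_subset[of _ "{..nat \<lfloor>1 / \<epsilon>\<rfloor>}"]) (auto simp: S_def le_nat_floor)
  have "P n \<epsilon> (SOME m. P (Max (S \<epsilon>)) \<epsilon> m)"
    if "0 < \<epsilon>" "\<epsilon> < min (e n) (1 / (real n + 1))" for n \<epsilon>
  proof -
    have "real n * \<epsilon> \<le> 1" using that by (simp add: field_simps)
    then have n: "n \<in> S \<epsilon>" using that by (simp add: S_def field_simps)
    then have "Max (S \<epsilon>) \<in> S \<epsilon>" using fin by (intro Max_in) auto
    then have "\<exists>m. P (Max (S \<epsilon>)) \<epsilon> m" using e(2) that by (auto simp: S_def)
    then have "P (Max (S \<epsilon>)) \<epsilon> (SOME m. P (Max (S \<epsilon>)) \<epsilon> m)" by (rule someI_ex)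
    then show ?thesis by (rule anti[OF _ Max_ge[OF fin n]])
  qed
  then have "\<forall>\<^sub>F \<epsilon> in at_right 0. P n \<epsilon> (SOME m. P (Max (S \<epsilon>)) \<epsilon> m)" for n
    unfolding eventually_at_right_field using e(1)[of n]
    by (intro exI[of _ "min (e n) (1 / (real n + 1))"] conjI allI impI) simp_all
  then show ?thesis by (intro exI allI)
qed

section \<open>Mutual singularity of distinct ergodic measures\<close>

text \<open>The union of all translates of a Hahn positive set of \<open>\<mu> - \<nu>\<close> is again positive, and it is
  strictly invariant, so ergodicity of both measures applies to it.\<close>

lemma ergodic_measures_separated:
  fixes T :: "'g::group_add \<Rightarrow> 'x::metric_space \<Rightarrow> 'x"
  assumes count: "countable (UNIV :: 'g set)" and act: "is_action T"
    and \<mu>: "\<mu> \<in> ergodic_measures T" and \<nu>: "\<nu> \<in> ergodic_measures T" and "\<mu> \<noteq> \<nu>"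
  shows "\<exists>A\<in>sets borel. measure \<mu> A = 1 \<and> measure \<nu> A = 0"
proof -
  have [simp]: "sets \<mu> = sets borel" "sets \<nu> = sets borel"
    using \<mu> \<nu> by (auto simp: ergodic_measures_def invariant_measures_def)
  have [simp]: "space \<mu> = UNIV" "space \<nu> = UNIV"
    using sets_eq_imp_space_eq[of \<mu> borel] sets_eq_imp_space_eq[of \<nu> borel] by auto
  interpret \<mu>: prob_space \<mu> using \<mu> by (simp add: ergodic_measures_def invariant_measures_def)
  interpret \<nu>: prob_space \<nu> using \<nu> by (simp add: ergodic_measures_def invariant_measures_def)
  have meas: "T g \<in> borel_measurable borel" for g
    using act by (auto simp: is_action_def intro: borel_measurable_continuous_onI)
  have vimage_sets: "T g -` X \<in> sets borel" if "X \<in> sets borel" for g X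
    using measurable_sets[OF meas that] by simp
  have comp: "T (g + h) x = T g (T h x)" for g h x
    using act by (simp add: is_action_def)
  have T_inv: "T (- g) (T g x) = x" "T g (T (- g) x) = x" for g x
    using act by (simp_all add: comp[symmetric]) (simp_all add: is_action_def)
  have inv: "emeasure M (T g -` X) = emeasure M X"
    if M: "M \<in> {\<mu>, \<nu>}" and X: "X \<in> sets borel" for M g X
  proof -
    have "distr M borel (T g) = M" "sets M = sets borel" "space M = UNIV"
      using M \<mu> \<nu> by (auto simp: ergodic_measures_def invariant_measures_def)
    then show ?thesis
      using emeasure_distr[of "T g" M borel X] meas[of g] X
      by (simp cong: measurable_cong_sets)
  qed
  obtain P where P: "P \<in> sets borel"
    and pos: "\<And>X. X \<in> sets borel \<Longrightarrow> X \<subseteq> P \<Longrightarrow> emeasure \<nu> X \<le> emeasure \<mu> X"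
    and neg: "\<And>X. X \<in> sets borel \<Longrightarrow> X \<inter> P = {} \<Longrightarrow> emeasure \<mu> X \<le> emeasure \<nu> X"
    using finite_unsigned_Hahn_decomposition[OF \<mu>.finite_measure_axioms \<nu>.finite_measure_axioms] by auto
  \<comment> \<open>The preimage of X under \<open>T (- g)\<close> lies in \<open>P\<close>, and
    invariance of both measures carries the inequality back to X.\<close>
  have pos_T: "emeasure \<nu> X \<le> emeasure \<mu> X" if "X \<in> sets borel" "X \<subseteq> T g -` P" for X g
  proof -
    have "T (- g) -` X \<subseteq> P" using that T_inv by (auto dest!: subsetD)
    then have "emeasure \<nu> (T (- g) -` X) \<le> emeasure \<mu> (T (- g) -` X)"
      using that by (intro pos vimage_sets)
    then show ?thesis using that by (simp add: inv)
  qed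
  define A where "A = (\<Union>g. T g -` P)"
  have A: "A \<in> sets borel"
    unfolding A_def using count P by (intro sets.countable_UN'') (auto intro: vimage_sets)
  have pos_A: "emeasure \<nu> X \<le> emeasure \<mu> X" if X: "X \<in> sets borel" "X \<subseteq> A" for X
  proof -
    \<comment> \<open>Countability of the group allows the translates to be enumerated and made
      disjoint. Each piece of X then lies in a single translate, and the inequalities for the pieces
      add up.\<close>
    define Y where "Y n = T (from_nat_into UNIV n) -` P" for n :: nat
    have Y: "range Y \<subseteq> sets borel" using P by (auto simp: Y_def intro: vimage_sets)
    have "A = (\<Union>g\<in>range (from_nat_into (UNIV :: 'g set)). T g -` P)"
      using range_from_nat_into[OF UNIV_not_empty count] by (simp add: A_def)
    then have "A = (\<Union>n. Y n)" by (simp only: Y_def image_image)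
    then have XY: "X = (\<Union>n. X \<inter> disjointed Y n)"
      using X by (auto simp: UN_disjointed_eq simp flip: Int_UN_distrib)
    have disj: "disjoint_family (\<lambda>n. X \<inter> disjointed Y n)"
      using disjoint_family_disjointed[of Y] by (auto simp: disjoint_family_on_def)
    have sets: "X \<inter> disjointed Y n \<in> sets borel" for n
      using X sets.range_disjointed_sets[OF Y] by auto
    have "X \<inter> disjointed Y n \<subseteq> T (from_nat_into UNIV n) -` P" for n
      using disjointed_subset[of Y n] by (auto simp: Y_def)
    then have "(\<Sum>n. emeasure \<nu> (X \<inter> disjointed Y n)) \<le> (\<Sum>n. emeasure \<mu> (X \<inter> disjointed Y n))"
      using sets by (intro suminf_le pos_T) auto
    moreover have "(\<Sum>n. emeasure M (X \<inter> disjointed Y n)) = emeasure M X" if "sets M = sets borel" for M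
      using suminf_emeasure[of "\<lambda>n. X \<inter> disjointed Y n" M] sets disj XY that
      by (simp add: image_subset_iff)
    ultimately show ?thesis by simp
  qed
  have invA: "T h -` A = A" for h
  proof -
    have "T h -` A = (\<Union>g. T (g + h) -` P)"
      by (simp add: A_def vimage_UN) (simp add: vimage_def comp)
    also have "\<dots> = (\<Union>g\<in>(\<lambda>g. g + h) ` UNIV. T g -` P)" by (simp only: image_image)
    also have "(\<lambda>g. g + h) ` UNIV = UNIV" by (rule surj_plus_right)
    finally show ?thesis by (simp add: A_def)
  qed
  \<comment> \<open>Unequal measures differ on some Borel set. Since both have total mass 1, passing
    to the complement if necessary puts the excess on the side of \<mu>.\<close>
  obtain B where B: "B \<in> sets borel" and less: "measure \<nu> B < measure \<mu> B"
  proof -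
    obtain X where X: "X \<in> sets borel" "measure \<mu> X \<noteq> measure \<nu> X"
      using \<open>\<mu> \<noteq> \<nu>\<close> measure_eqI[of \<mu> \<nu>] by (auto simp: \<mu>.emeasure_eq_measure \<nu>.emeasure_eq_measure)
    then have "measure \<nu> (UNIV - X) < measure \<mu> (UNIV - X)" if "measure \<mu> X < measure \<nu> X"
      using \<mu>.prob_compl[of X] \<nu>.prob_compl[of X] that by simp
    then show ?thesis using that[of X] that[of "UNIV - X"] X by force
  qed
  \<comment> \<open>Outside \<open>P\<close> the measure \<nu> dominates, so discarding
    \<open>B - P\<close> cannot reduce the excess of \<mu>.\<close>
  have "measure \<mu> (B - P) \<le> measure \<nu> (B - P)"
    using neg[of "B - P"] B P by (auto simp: \<mu>.emeasure_eq_measure \<nu>.emeasure_eq_measure)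
  moreover have "measure M B = measure M (B \<inter> P) + measure M (B - P)" if "M \<in> {\<mu>, \<nu>}" for M
    using that B P \<mu>.finite_measure_Union[of "B \<inter> P" "B - P"] \<nu>.finite_measure_Union[of "B \<inter> P" "B - P"]
    by (auto simp: Int_Diff_Un Int_Diff_disjoint)
  ultimately have BP: "measure \<nu> (B \<inter> P) < measure \<mu> (B \<inter> P)"
    using less by fastforce
  have "T 0 -` P = P" using act by (simp add: is_action_def)
  then have sub: "P \<subseteq> A" unfolding A_def by blast
  \<comment> \<open>The rest of \<open>A\<close> is positive as well, so the excess on
    \<open>B \<inter> P\<close> survives on \<open>A\<close>. As \<open>A\<close> is invariant, both
    masses are 0 or 1, and strictness leaves only 1 for \<mu> and 0 for \<nu>.\<close>
  have "measure \<nu> (A - B \<inter> P) \<le> measure \<mu> (A - B \<inter> P)"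
    using pos_A[of "A - B \<inter> P"] A B P by (auto simp: \<mu>.emeasure_eq_measure \<nu>.emeasure_eq_measure)
  moreover have "measure \<mu> (A - B \<inter> P) = measure \<mu> A - measure \<mu> (B \<inter> P)"
     "measure \<nu> (A - B \<inter> P) = measure \<nu> A - measure \<nu> (B \<inter> P)"
    using \<mu>.finite_measure_Diff[of A "B \<inter> P"] \<nu>.finite_measure_Diff[of A "B \<inter> P"] A B P sub by auto
  ultimately have "measure \<nu> A < measure \<mu> A" using BP by linarith
  moreover have "measure \<mu> A = 0 \<or> measure \<mu> A = 1" "measure \<nu> A = 0 \<or> measure \<nu> A = 1"
    using \<mu> \<nu> A invA by (auto simp: ergodic_measures_def)
  ultimately show ?thesis using A by force
qed

section \<open>Integration against mixtures\<close>

lemma sets_mixture [simp]: "sets (mixture w) = sets borel"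
  unfolding mixture_def using sets.sigma_sets_eq[of borel] by (simp add: sets_measure_of)

lemma space_mixture [simp]: "space (mixture w) = UNIV"
  using sets_eq_imp_space_eq[OF sets_mixture] by simp

text \<open>Serves to evaluate two weight functions over one finite index set containing both
  supports.\<close>

lemma sum_weights_superset:
  fixes w f :: "'a \<Rightarrow> real"
  assumes "finite S" "{\<nu>. w \<nu> \<noteq> 0} \<subseteq> S"
  shows "(\<Sum>\<nu>\<in>{\<nu>. w \<nu> \<noteq> 0}. w \<nu> * f \<nu>) = (\<Sum>\<nu>\<in>S. w \<nu> * f \<nu>)"
  using assms by (intro sum.mono_neutral_left) auto

text \<open>\<open>mixture\<close> is given by a bare set function, so countable additivity has to
  be checked; it follows by exchanging the sum over the components with the series. For infinite
  support both sides are 0, the default value of such a sum.\<close>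

lemma emeasure_mixture:
  fixes w :: "'x::metric_space measure \<Rightarrow> real"
  assumes sets: "\<And>\<nu>. w \<nu> \<noteq> 0 \<Longrightarrow> sets \<nu> = sets borel" and A: "A \<in> sets borel"
  shows "emeasure (mixture w) A = (\<Sum>\<nu>\<in>{\<nu>. w \<nu> \<noteq> 0}. ennreal (w \<nu>) * emeasure \<nu> A)"
  unfolding mixture_def
proof (rule emeasure_measure_of_sigma)
  show "sigma_algebra UNIV (sets borel)"
    by (metis sets.sigma_algebra_axioms space_borel)
  show "positive (sets borel) (\<lambda>A. \<Sum>\<nu>\<in>{\<nu>. w \<nu> \<noteq> 0}. ennreal (w \<nu>) * emeasure \<nu> A)"
    by (simp add: positive_def)
  show "countably_additive (sets borel) (\<lambda>A. \<Sum>\<nu>\<in>{\<nu>. w \<nu> \<noteq> 0}. ennreal (w \<nu>) * emeasure \<nu> A)"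
  proof (rule countably_additiveI)
    fix X :: "nat \<Rightarrow> 'x set" assume X: "range X \<subseteq> sets borel" "disjoint_family X"
    have "(\<Sum>i. \<Sum>\<nu>\<in>{\<nu>. w \<nu> \<noteq> 0}. ennreal (w \<nu>) * emeasure \<nu> (X i))
        = (\<Sum>\<nu>\<in>{\<nu>. w \<nu> \<noteq> 0}. \<Sum>i. ennreal (w \<nu>) * emeasure \<nu> (X i))"
      by (intro suminf_sum summableI)
    also have "\<dots> = (\<Sum>\<nu>\<in>{\<nu>. w \<nu> \<noteq> 0}. ennreal (w \<nu>) * emeasure \<nu> (\<Union>i. X i))"
      using X sets by (intro sum.cong refl) (auto simp: ennreal_suminf_cmult suminf_emeasure)
    finally show "(\<Sum>i. \<Sum>\<nu>\<in>{\<nu>. w \<nu> \<noteq> 0}. ennreal (w \<nu>) * emeasure \<nu> (X i))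
        = (\<Sum>\<nu>\<in>{\<nu>. w \<nu> \<noteq> 0}. ennreal (w \<nu>) * emeasure \<nu> (\<Union> (range X)))" .
  qed
qed (rule A)

lemma nn_integral_mixture:
  fixes w :: "'x::metric_space measure \<Rightarrow> real"
  assumes sets: "\<And>\<nu>. w \<nu> \<noteq> 0 \<Longrightarrow> sets \<nu> = sets borel" and u: "u \<in> borel_measurable borel"
  shows "nn_integral (mixture w) u = (\<Sum>\<nu>\<in>{\<nu>. w \<nu> \<noteq> 0}. ennreal (w \<nu>) * nn_integral \<nu> u)"
proof -
  have meas: "g \<in> borel_measurable (mixture w)" if "g \<in> borel_measurable borel" for g :: "'x \<Rightarrow> ennreal"
    by (subst measurable_cong_sets[OF sets_mixture refl]) (rule that)
  have meas': "g \<in> borel_measurable \<nu>"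
    if "g \<in> borel_measurable borel" "w \<nu> \<noteq> 0" for g :: "'x \<Rightarrow> ennreal" and \<nu>
    by (subst measurable_cong_sets[OF sets[OF that(2)] refl]) (rule that(1))
  show ?thesis
    using u
  proof (induction rule: borel_measurable_induct)
    case (cong f g)
    have "f = g" using cong.hyps by (auto simp: fun_eq_iff)
    then show ?case using cong.IH by simp
  next
    case (set A)
    then show ?case using sets by (simp add: emeasure_mixture)
  next
    case (mult u c)
    show ?case
      using mult.IH meas[OF mult.hyps(2)] meas'[OF mult.hyps(2)]
      by (simp add: nn_integral_cmult sum_distrib_left mult.left_commute)
  next
    case (add u v)
    show ?case
      using add.IH meas[OF add.hyps(1)] meas[OF add.hyps(3)] meas'[OF add.hyps(1)] meas'[OF add.hyps(3)]
      by (simp add: nn_integral_add sum.distrib distrib_left)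
  next
    case (seq U)
    have sup_U: "(SUP i. U i) = (\<lambda>x. SUP i. U i x)" by (auto simp: fun_eq_iff image_image)
    have U: "U i \<in> borel_measurable (mixture w)" for i
      using seq.hyps(1) by (rule meas)
    have U': "U i \<in> borel_measurable \<nu>" if "w \<nu> \<noteq> 0" for \<nu> i
      using seq.hyps(1) that by (rule meas')
    have mono: "incseq (\<lambda>i. ennreal (w \<nu>) * nn_integral \<nu> (U i))" for \<nu>
      using \<open>incseq U\<close> by (auto simp: incseq_def le_fun_def intro!: mult_left_mono nn_integral_mono)
    have "nn_integral (mixture w) (SUP i. U i) = (SUP i. nn_integral (mixture w) (U i))"
      using nn_integral_monotone_convergence_SUP[OF \<open>incseq U\<close> U] by (simp only: sup_U)
    also have "\<dots> = (SUP i. \<Sum>\<nu>\<in>{\<nu>. w \<nu> \<noteq> 0}. ennreal (w \<nu>) * nn_integral \<nu> (U i))"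
      by (simp only: seq.IH)
    also have "\<dots> = (\<Sum>\<nu>\<in>{\<nu>. w \<nu> \<noteq> 0}. SUP i. ennreal (w \<nu>) * nn_integral \<nu> (U i))"
      by (rule ennreal_SUP_sum) (rule mono)
    also have "\<dots> = (\<Sum>\<nu>\<in>{\<nu>. w \<nu> \<noteq> 0}. ennreal (w \<nu>) * nn_integral \<nu> (SUP i. U i))"
    proof (rule sum.cong)
      fix \<nu> assume "\<nu> \<in> {\<nu>. w \<nu> \<noteq> 0}"
      then have "nn_integral \<nu> (SUP i. U i) = (SUP i. nn_integral \<nu> (U i))"
        using nn_integral_monotone_convergence_SUP[OF \<open>incseq U\<close> U'] by (simp add: sup_U)
      then show "(SUP i. ennreal (w \<nu>) * nn_integral \<nu> (U i)) = ennreal (w \<nu>) * nn_integral \<nu> (SUP i. U i)"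
        by (simp add: SUP_mult_left_ennreal)
    qed simp
    finally show ?case .
  qed
qed

text \<open>The formula for nonnegative functions is applied to the positive and negative parts.
  Their integrals are finite under every component, which permits the passage from
  \<open>ennreal\<close> to real sums.\<close>

lemma integral_mixture:
  fixes f :: "'x::metric_space \<Rightarrow> real"
  assumes sets: "\<And>\<nu>. w \<nu> \<noteq> 0 \<Longrightarrow> sets \<nu> = sets borel"
    and pos: "\<And>\<nu>. w \<nu> \<noteq> 0 \<Longrightarrow> 0 < w \<nu>"
    and f: "\<And>\<nu>. w \<nu> \<noteq> 0 \<Longrightarrow> integrable \<nu> f" "f \<in> borel_measurable borel"
  shows "integral\<^sup>L (mixture w) f = (\<Sum>\<nu>\<in>{\<nu>. w \<nu> \<noteq> 0}. w \<nu> * integral\<^sup>L \<nu> f)"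
proof -
  have eq: "nn_integral (mixture w) g = ennreal (\<Sum>\<nu>\<in>{\<nu>. w \<nu> \<noteq> 0}. w \<nu> * enn2real (nn_integral \<nu> g))"
    if g: "\<And>\<nu>. w \<nu> \<noteq> 0 \<Longrightarrow> nn_integral \<nu> g < \<infinity>" "g \<in> borel_measurable borel" for g
  proof -
    have "nn_integral (mixture w) g = (\<Sum>\<nu>\<in>{\<nu>. w \<nu> \<noteq> 0}. ennreal (w \<nu> * enn2real (nn_integral \<nu> g)))"
      using sets g pos by (subst nn_integral_mixture) (auto intro!: sum.cong simp: ennreal_mult less_imp_le)
    also have "\<dots> = ennreal (\<Sum>\<nu>\<in>{\<nu>. w \<nu> \<noteq> 0}. w \<nu> * enn2real (nn_integral \<nu> g))"
      using pos by (intro sum_ennreal) (simp add: less_imp_le)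
    finally show ?thesis .
  qed
  define p where "p = (\<lambda>x. ennreal (f x))"
  define n where "n = (\<lambda>x. ennreal (- f x))"
  have pn: "p \<in> borel_measurable borel" "n \<in> borel_measurable borel"
    using f(2) by (auto simp: p_def n_def)
  have fin_pn: "nn_integral \<nu> p < \<infinity>" "nn_integral \<nu> n < \<infinity>" if "w \<nu> \<noteq> 0" for \<nu>
    using f(1)[OF that] by (auto simp: p_def n_def real_integrable_def less_top)
  have nonneg: "0 \<le> (\<Sum>\<nu>\<in>{\<nu>. w \<nu> \<noteq> 0}. w \<nu> * enn2real (nn_integral \<nu> g))" for g
    using pos by (intro sum_nonneg) (simp add: less_imp_le)
  have "integrable (mixture w) f"
    using f(2) eq[OF fin_pn(1) pn(1)] eq[OF fin_pn(2) pn(2)]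
    by (simp add: real_integrable_def p_def n_def cong: measurable_cong_sets)
  then have "integral\<^sup>L (mixture w) f
      = enn2real (nn_integral (mixture w) p) - enn2real (nn_integral (mixture w) n)"
    unfolding p_def n_def by (rule real_lebesgue_integral_def)
  also have "\<dots> = (\<Sum>\<nu>\<in>{\<nu>. w \<nu> \<noteq> 0}. w \<nu> * (enn2real (nn_integral \<nu> p) - enn2real (nn_integral \<nu> n)))"
    using eq[OF fin_pn(1) pn(1)] eq[OF fin_pn(2) pn(2)] nonneg
    by (simp add: right_diff_distrib sum_subtractf)
  also have "\<dots> = (\<Sum>\<nu>\<in>{\<nu>. w \<nu> \<noteq> 0}. w \<nu> * integral\<^sup>L \<nu> f)"
    unfolding p_def n_def using f(1) by (intro sum.cong refl) (simp add: real_lebesgue_integral_def)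
  finally show ?thesis .
qed

section \<open>Convex combinations of ergodic measures\<close>

lemma ergodic_measuresD:
  assumes "\<nu> \<in> ergodic_measures T"
  shows "prob_space \<nu>" "sets \<nu> = sets borel"
  using assms by (auto simp: ergodic_measures_def invariant_measures_def)

lemma co_repD:
  assumes "co_rep T \<mu> w"
  shows "finite {\<nu>. w \<nu> \<noteq> 0}" "\<And>\<nu>. 0 \<le> w \<nu>" "\<And>\<nu>. w \<nu> \<noteq> 0 \<Longrightarrow> 0 < w \<nu>"
    "\<And>\<nu>. w \<nu> \<noteq> 0 \<Longrightarrow> \<nu> \<in> ergodic_measures T" "(\<Sum>\<nu>\<in>{\<nu>. w \<nu> \<noteq> 0}. w \<nu>) = 1"
    "\<mu> = mixture w" "\<And>\<nu>. w \<nu> \<noteq> 0 \<Longrightarrow> prob_space \<nu>" "\<And>\<nu>. w \<nu> \<noteq> 0 \<Longrightarrow> sets \<nu> = sets borel"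
proof -
  show pos: "0 < w \<nu>" "\<nu> \<in> ergodic_measures T" if "w \<nu> \<noteq> 0" for \<nu>
    using assms that by (simp_all add: co_rep_def)
  show "0 \<le> w \<nu>" for \<nu>
    using pos(1)[of \<nu>] by (cases "w \<nu> = 0") simp_all
  show "prob_space \<nu>" "sets \<nu> = sets borel" if "w \<nu> \<noteq> 0" for \<nu>
    using ergodic_measuresD[OF pos(2)[OF that]] by simp_all
  show "finite {\<nu>. w \<nu> \<noteq> 0}" "(\<Sum>\<nu>\<in>{\<nu>. w \<nu> \<noteq> 0}. w \<nu>) = 1" "\<mu> = mixture w"
    using assms by (simp_all only: co_rep_def)
qed

lemma measure_co_rep:
  assumes w: "co_rep T \<mu> w" and A: "A \<in> sets borel"
    and S: "finite S" "{\<nu>. w \<nu> \<noteq> 0} \<subseteq> S"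
  shows "measure \<mu> A = (\<Sum>\<nu>\<in>S. w \<nu> * measure \<nu> A)"
proof -
  have "emeasure \<mu> A = (\<Sum>\<nu>\<in>{\<nu>. w \<nu> \<noteq> 0}. ennreal (w \<nu>) * emeasure \<nu> A)"
    using co_repD[OF w] A by (simp add: emeasure_mixture)
  also have "\<dots> = (\<Sum>\<nu>\<in>{\<nu>. w \<nu> \<noteq> 0}. ennreal (w \<nu> * measure \<nu> A))"
    using co_repD(2,7)[OF w]
    by (intro sum.cong refl)
      (simp add: ennreal_mult finite_measure.emeasure_eq_measure prob_space.finite_measure)
  also have "\<dots> = ennreal (\<Sum>\<nu>\<in>{\<nu>. w \<nu> \<noteq> 0}. w \<nu> * measure \<nu> A)"
    using co_repD(2)[OF w] by (intro sum_ennreal) simp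
  also have "\<dots> = ennreal (\<Sum>\<nu>\<in>S. w \<nu> * measure \<nu> A)"
    using S by (simp add: sum_weights_superset)
  finally show ?thesis
    using co_repD(2)[OF w] by (simp add: measure_def sum_nonneg)
qed

lemma prob_space_co_rep:
  assumes w: "co_rep T \<mu> w"
  shows "prob_space \<mu>"
proof (rule prob_spaceI)
  have "emeasure \<mu> UNIV = (\<Sum>\<nu>\<in>{\<nu>. w \<nu> \<noteq> 0}. ennreal (w \<nu>) * emeasure \<nu> UNIV)"
    using co_repD[OF w] by (simp add: emeasure_mixture)
  also have "\<dots> = (\<Sum>\<nu>\<in>{\<nu>. w \<nu> \<noteq> 0}. ennreal (w \<nu>))"
  proof (rule sum.cong)
    fix \<nu> assume "\<nu> \<in> {\<nu>. w \<nu> \<noteq> 0}"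
    then have "prob_space \<nu>" "space \<nu> = UNIV"
      using co_repD(7,8)[OF w, of \<nu>] sets_eq_imp_space_eq[of \<nu> borel] by auto
    then show "ennreal (w \<nu>) * emeasure \<nu> UNIV = ennreal (w \<nu>)"
      using prob_space.emeasure_space_1[of \<nu>] by simp
  qed simp
  also have "\<dots> = 1"
    using co_repD(2,5)[OF w] by (simp add: sum_ennreal)
  finally show "emeasure \<mu> (space \<mu>) = 1"
    using co_repD(6)[OF w] by simp
qed

lemma integral_co_rep:
  fixes f :: "'x::metric_space \<Rightarrow> real"
  assumes w: "co_rep T \<mu> w" and f: "f \<in> borel_measurable borel" "\<And>x. \<bar>f x\<bar> \<le> B"
    and S: "finite S" "{\<nu>. w \<nu> \<noteq> 0} \<subseteq> S"
  shows "integral\<^sup>L \<mu> f = (\<Sum>\<nu>\<in>S. w \<nu> * integral\<^sup>L \<nu> f)"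
proof -
  have "integrable \<nu> f" if "w \<nu> \<noteq> 0" for \<nu>
  proof -
    have "f \<in> borel_measurable \<nu>"
      using f(1) measurable_cong_sets[OF co_repD(8)[OF w that] refl] by blast
    then show ?thesis
      using f(2) co_repD(7)[OF w that] prob_space.finite_measure
      by (intro finite_measure.integrable_const_bound[where B = B]) auto
  qed
  then have "integral\<^sup>L (mixture w) f = (\<Sum>\<nu>\<in>{\<nu>. w \<nu> \<noteq> 0}. w \<nu> * integral\<^sup>L \<nu> f)"
    using co_repD[OF w] f by (intro integral_mixture) auto
  then show ?thesis
    using S co_repD(6)[OF w] by (simp add: sum_weights_superset)
qed

text \<open>Distinct ergodic measures are mutually singular, so each weight is the mass of a set
  that carries exactly one of the measures involved.\<close>

lemma co_rep_unique:
  fixes T :: "'g::group_add \<Rightarrow> 'x::metric_space \<Rightarrow> 'x"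
  assumes count: "countable (UNIV :: 'g set)" and act: "is_action T"
    and w: "co_rep T \<mu> w" and w': "co_rep T \<mu> w'"
  shows "w = w'"
proof
  fix \<nu>
  define S where "S = {\<nu>. w \<nu> \<noteq> 0} \<union> {\<nu>. w' \<nu> \<noteq> 0}"
  have S: "finite S" "S \<subseteq> ergodic_measures T"
    using co_repD(1,4)[OF w] co_repD(1,4)[OF w'] by (auto simp: S_def)
  show "w \<nu> = w' \<nu>"
  proof (cases "\<nu> \<in> S")
    case True
    then have "\<forall>\<rho>\<in>S - {\<nu>}. \<exists>A\<in>sets borel. measure \<nu> A = 1 \<and> measure \<rho> A = 0"
      using S by (intro ballI ergodic_measures_separated[OF count act]) auto
    then obtain A where A: "\<And>\<rho>. \<rho> \<in> S - {\<nu>} \<Longrightarrow> A \<rho> \<in> sets borel"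
      "\<And>\<rho>. \<rho> \<in> S - {\<nu>} \<Longrightarrow> measure \<nu> (A \<rho>) = 1" "\<And>\<rho>. \<rho> \<in> S - {\<nu>} \<Longrightarrow> measure \<rho> (A \<rho>) = 0"
      by metis
    \<comment> \<open>Each \<open>A \<rho>\<close> has full \<nu>-mass and is \<rho>-null. Hence
      \<open>D\<close> is \<nu>-null, while its complement is null for every other measure in
      \<open>S\<close>; the mass of \<open>UNIV - D\<close> therefore reads off the weight of
      \<nu>.\<close>
    define D where "D = (\<Union>\<rho>\<in>S - {\<nu>}. UNIV - A \<rho>)"
    have D: "D \<in> sets borel" 
      using A(1) S(1) unfolding D_def by (intro sets.finite_UN sets.Diff) auto
    have erg: "prob_space \<rho>" "sets \<rho> = sets borel" "space \<rho> = UNIV" if "\<rho> \<in> S" for \<rho>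
      using ergodic_measuresD[of \<rho> T] that S sets_eq_imp_space_eq[of \<rho> borel] by auto
    interpret \<nu>: prob_space \<nu> using erg True by simp
    have "measure \<nu> D \<le> (\<Sum>\<rho>\<in>S - {\<nu>}. measure \<nu> (UNIV - A \<rho>))"
      unfolding D_def using S A(1) erg(2)[OF True]
      by (intro \<nu>.finite_measure_subadditive_finite) auto
    also have "\<dots> = 0"
      using A \<nu>.prob_compl erg(2,3)[OF True] by (intro sum.neutral) auto
    finally have "measure \<nu> (UNIV - D) = 1"
      using \<nu>.prob_compl[of D] D erg(2,3)[OF True] measure_nonneg[of \<nu> D] by simp
    moreover have "measure \<rho> (UNIV - D) = 0" if "\<rho> \<in> S - {\<nu>}" for \<rho>
    proof -
      interpret \<rho>: prob_space \<rho> using erg that by simp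
      have "measure \<rho> (UNIV - D) \<le> measure \<rho> (A \<rho>)"
        using that A(1) erg by (intro \<rho>.finite_measure_mono) (auto simp: D_def)
      then show ?thesis using A(3)[OF that] measure_nonneg[of \<rho> "UNIV - D"] by simp
    qed
    ultimately have "(\<Sum>\<rho>\<in>S. u \<rho> * measure \<rho> (UNIV - D)) = u \<nu>" for u :: "'x measure \<Rightarrow> real"
      using S(1) True by (subst sum.remove[of S \<nu>]) auto
    then show ?thesis
      using measure_co_rep[OF w _ S(1), of "UNIV - D"] measure_co_rep[OF w' _ S(1), of "UNIV - D"] D
      by (auto simp: S_def)
  next
    case False
    then show ?thesis by (simp add: S_def)
  qed
qed

lemma Fmix_co_rep:
  fixes T :: "'g::group_add \<Rightarrow> 'x::metric_space \<Rightarrow> 'x"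
  assumes count: "countable (UNIV :: 'g set)" and act: "is_action T" and w: "co_rep T \<mu> w"
    and S: "finite S" "{\<nu>. w \<nu> \<noteq> 0} \<subseteq> S"
  shows "Fmix T F \<mu> \<epsilon> = (\<Sum>\<nu>\<in>S. w \<nu> * h_eps \<nu> T F \<epsilon>)"
proof -
  have "Fmix T F \<mu> \<epsilon> = (\<Sum>\<nu>\<in>{\<nu>. w \<nu> \<noteq> 0}. w \<nu> * h_eps \<nu> T F \<epsilon>)"
    unfolding Fmix_def using w co_rep_unique[OF count act w] by (intro the_equality) blast+
  then show ?thesis using S by (simp add: sum_weights_superset)
qed

text \<open>Interpolating the weights pointwise merges common components automatically, and both
  entropy and integrals are linear in the weights. A single \<rho> serves the entropy at scale
  \<epsilon> and all bounded Borel functions at once.\<close>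

lemma coE_convex:
  fixes T :: "'g::group_add \<Rightarrow> 'x::metric_space \<Rightarrow> 'x"
  assumes count: "countable (UNIV :: 'g set)" and act: "is_action T"
    and \<mu>: "\<mu> \<in> coE T" and \<mu>': "\<mu>' \<in> coE T" and s: "0 \<le> s" "s \<le> 1"
  shows "\<exists>\<rho>\<in>coE T. Fmix T F \<rho> \<epsilon> = (1 - s) * Fmix T F \<mu> \<epsilon> + s * Fmix T F \<mu>' \<epsilon> \<and>
    (\<forall>f::'x \<Rightarrow> real. f \<in> borel_measurable borel \<longrightarrow> (\<exists>B. \<forall>x. \<bar>f x\<bar> \<le> B) \<longrightarrow>
       integral\<^sup>L \<rho> f = (1 - s) * integral\<^sup>L \<mu> f + s * integral\<^sup>L \<mu>' f)"
proof -
  obtain w w' where w: "co_rep T \<mu> w" and w': "co_rep T \<mu>' w'"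
    using \<mu> \<mu>' by (auto simp: coE_def)
  define S where "S = {\<nu>. w \<nu> \<noteq> 0} \<union> {\<nu>. w' \<nu> \<noteq> 0}"
  have S: "finite S" "{\<nu>. w \<nu> \<noteq> 0} \<subseteq> S" "{\<nu>. w' \<nu> \<noteq> 0} \<subseteq> S"
    using co_repD(1)[OF w] co_repD(1)[OF w'] by (auto simp: S_def)
  define u where "u \<nu> = (1 - s) * w \<nu> + s * w' \<nu>" for \<nu>
  have Su: "{\<nu>. u \<nu> \<noteq> 0} \<subseteq> S" by (auto simp: u_def S_def)
  have sum_u: "(\<Sum>\<nu>\<in>S. u \<nu> * g \<nu>) = (1 - s) * (\<Sum>\<nu>\<in>S. w \<nu> * g \<nu>) + s * (\<Sum>\<nu>\<in>S. w' \<nu> * g \<nu>)"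
    for g :: "'x measure \<Rightarrow> real"
    unfolding u_def sum_distrib_left sum.distrib[symmetric]
    by (rule sum.cong) (simp_all add: algebra_simps)
  have one: "(\<Sum>\<nu>\<in>{\<nu>. v \<nu> \<noteq> 0}. v \<nu>) = (\<Sum>\<nu>\<in>S. v \<nu> * 1)"
    if "{\<nu>. v \<nu> \<noteq> 0} \<subseteq> S" for v :: "'x measure \<Rightarrow> real"
    using sum_weights_superset[of S v "\<lambda>_. 1"] S(1) that by simp
  have "co_rep T (mixture u) u"
    unfolding co_rep_def
  proof (intro conjI allI impI refl)
    show "finite {\<nu>. u \<nu> \<noteq> 0}" using Su S(1) by (rule finite_subset)
    show "(\<Sum>\<nu>\<in>{\<nu>. u \<nu> \<noteq> 0}. u \<nu>) = 1"
      using co_repD(5)[OF w] co_repD(5)[OF w'] by (simp add: one[OF Su] one[OF S(2)] one[OF S(3)] sum_u[of "\<lambda>_. 1", simplified])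
  next
    fix \<nu> assume u: "u \<nu> \<noteq> 0"
    have "0 \<le> u \<nu>" using co_repD(2)[OF w] co_repD(2)[OF w'] s by (simp add: u_def)
    with u show "0 < u \<nu>" by simp
    from u show "\<nu> \<in> ergodic_measures T"
      using Su S_def co_repD(4)[OF w] co_repD(4)[OF w'] by blast
  qed
  note u = this
  show ?thesis
  proof (intro bexI conjI allI impI)
    show "mixture u \<in> coE T" using u by (auto simp: coE_def)
    show "Fmix T F (mixture u) \<epsilon> = (1 - s) * Fmix T F \<mu> \<epsilon> + s * Fmix T F \<mu>' \<epsilon>"
      by (simp add: Fmix_co_rep[OF count act u S(1) Su] Fmix_co_rep[OF count act w S(1,2)]
          Fmix_co_rep[OF count act w' S(1,3)] sum_u)
    fix f :: "'x \<Rightarrow> real" assume f: "f \<in> borel_measurable borel" and "\<exists>B. \<forall>x. \<bar>f x\<bar> \<le> B"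
    then obtain B where B: "\<And>x. \<bar>f x\<bar> \<le> B" by blast
    show "integral\<^sup>L (mixture u) f = (1 - s) * integral\<^sup>L \<mu> f + s * integral\<^sup>L \<mu>' f"
      by (simp only: integral_co_rep[OF u f B S(1) Su] integral_co_rep[OF w f B S(1,2)]
          integral_co_rep[OF w' f B S(1,3)] sum_u)
  qed
qed

lemma coED:
  assumes "\<mu> \<in> coE T"
  shows "prob_space \<mu>" "sets \<mu> = sets borel"
proof -
  obtain w where w: "co_rep T \<mu> w" using assms by (auto simp: coE_def)
  show "prob_space \<mu>" using w by (rule prob_space_co_rep)
  show "sets \<mu> = sets borel" using co_repD(6)[OF w] by simp
qed

section \<open>Test functions for weak convergence on a compact space\<close>

lemma continuous_bounded_on_compact_space:
  fixes f :: "'x::metric_space \<Rightarrow> real"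
  assumes "compact (UNIV :: 'x set)" "continuous_on UNIV f"
  shows "\<exists>B. \<forall>x. \<bar>f x\<bar> \<le> B"
  using compact_imp_bounded[OF compact_continuous_image[OF assms(2,1)]]
  by (auto simp: bounded_iff)

lemma integrable_continuous_compact_space:
  fixes f :: "'x::metric_space \<Rightarrow> real"
  assumes K: "compact (UNIV :: 'x set)" and f: "continuous_on UNIV f"
    and \<mu>: "prob_space \<mu>" "sets \<mu> = sets borel"
  shows "integrable \<mu> f"
proof -
  obtain B where "\<And>x. \<bar>f x\<bar> \<le> B"
    using continuous_bounded_on_compact_space[OF K f] by blast
  moreover have "f \<in> borel_measurable \<mu>"
    by (subst measurable_cong_sets[OF \<mu>(2) refl]) (rule borel_measurable_continuous_onI[OF f])
  ultimately show ?thesis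
    by (intro finite_measure.integrable_const_bound[where B = B] prob_space.finite_measure \<mu>(1)) auto
qed

text \<open>Tent functions around a finite r-net, divided by their sum; the sum is positive because
  the balls of radius r around the net cover the space.\<close>

lemma partition_of_unity_small_support:
  assumes K: "compact (UNIV :: 'x::metric_space set)" and "0 < r"
  shows "\<exists>(S :: 'x set) (\<phi> :: 'x \<Rightarrow> 'x \<Rightarrow> real). finite S \<and> (\<forall>x. continuous_on UNIV (\<phi> x)) \<and>
    (\<forall>x y. 0 \<le> \<phi> x y) \<and> (\<forall>y. (\<Sum>x\<in>S. \<phi> x y) = 1) \<and> (\<forall>x y. \<phi> x y \<noteq> 0 \<longrightarrow> dist x y < r)"
proof -
  obtain S :: "'x set" where S: "finite S" "UNIV \<subseteq> (\<Union>x\<in>S. ball x r)"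
    using K \<open>0 < r\<close> unfolding compact_eq_totally_bounded by blast
  define \<psi> where "\<psi> x y = max 0 (r - dist x y)" for x y :: 'x
  define s where "s y = (\<Sum>x\<in>S. \<psi> x y)" for y
  have s: "0 < s y" for y
  proof -
    obtain x where "x \<in> S" "dist x y < r"
      using subsetD[OF S(2) UNIV_I[of y]] by auto
    then have "0 < \<psi> x y" by (simp add: \<psi>_def)
    then show ?thesis
      unfolding s_def using S(1) \<open>x \<in> S\<close> by (intro sum_pos2[of S x]) (auto simp: \<psi>_def)
  qed
  have \<psi>: "continuous_on UNIV (\<psi> x)" for x
    unfolding \<psi>_def by (intro continuous_intros)
  have "continuous_on UNIV (\<lambda>y. \<psi> x y / s y)" for x
    using s \<psi> unfolding s_def by (intro continuous_intros) (auto simp: less_imp_neq[symmetric])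
  moreover have "0 \<le> \<psi> x y / s y" for x y
    using s[of y] by (simp add: \<psi>_def)
  moreover have "(\<Sum>x\<in>S. \<psi> x y / s y) = 1" for y
    using s[of y] by (simp add: s_def flip: sum_divide_distrib)
  moreover have "\<psi> x y / s y \<noteq> 0 \<longrightarrow> dist x y < r" for x y
    by (auto simp: \<psi>_def max_def split: if_splits)
  ultimately show ?thesis using S(1)
    by (intro exI[of _ S] exI[of _ "\<lambda>x y. \<psi> x y / s y"]) blast
qed

text \<open>Countably many test functions suffice to detect weak convergence; partitions of unity
  avoid having to prove that \<open>C(X)\<close> is separable.\<close>

lemma weak_topology_test_functions:
  assumes K: "compact (UNIV :: 'x::metric_space set)"
  shows "\<exists>\<Phi> :: nat \<Rightarrow> ('x \<Rightarrow> real) set. (\<forall>n. finite (\<Phi> n) \<and> (\<forall>\<phi>\<in>\<Phi> n. continuous_on UNIV \<phi>)) \<and>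
    (\<forall>(f :: 'x \<Rightarrow> real) e. continuous_on UNIV f \<longrightarrow> 0 < e \<longrightarrow> (\<exists>n \<delta>. 0 < \<delta> \<and>
      (\<forall>\<mu> \<nu>. prob_space \<mu> \<longrightarrow> sets \<mu> = sets borel \<longrightarrow> prob_space \<nu> \<longrightarrow> sets \<nu> = sets borel \<longrightarrow>
         (\<forall>\<phi>\<in>\<Phi> n. \<bar>integral\<^sup>L \<mu> \<phi> - integral\<^sup>L \<nu> \<phi>\<bar> \<le> \<delta>) \<longrightarrow> \<bar>integral\<^sup>L \<mu> f - integral\<^sup>L \<nu> f\<bar> \<le> e)))"
proof -
  have "\<exists>(S :: 'x set) \<phi>. finite S \<and> (\<forall>x. continuous_on UNIV (\<phi> x)) \<and> (\<forall>x y. (0::real) \<le> \<phi> x y) \<and>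
      (\<forall>y. (\<Sum>x\<in>S. \<phi> x y) = 1) \<and> (\<forall>x y. \<phi> x y \<noteq> 0 \<longrightarrow> dist x y < 1 / (real n + 1))" for n
    using partition_of_unity_small_support[OF K, of "1 / (real n + 1)"] by simp
  then obtain S :: "nat \<Rightarrow> 'x set" and \<phi> :: "nat \<Rightarrow> 'x \<Rightarrow> 'x \<Rightarrow> real" where
    S: "\<And>n. finite (S n)" and cont: "\<And>n x. continuous_on UNIV (\<phi> n x)" and
    nonneg: "\<And>n x y. 0 \<le> \<phi> n x y" and one: "\<And>n y. (\<Sum>x\<in>S n. \<phi> n x y) = 1" and
    small: "\<And>n x y. \<phi> n x y \<noteq> 0 \<Longrightarrow> dist x y < 1 / (real n + 1)"
    by metis
  have "\<exists>n \<delta>. 0 < \<delta> \<and>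
      (\<forall>\<mu> \<nu>. prob_space \<mu> \<longrightarrow> sets \<mu> = sets borel \<longrightarrow> prob_space \<nu> \<longrightarrow> sets \<nu> = sets borel \<longrightarrow>
         (\<forall>\<psi>\<in>\<phi> n ` S n. \<bar>integral\<^sup>L \<mu> \<psi> - integral\<^sup>L \<nu> \<psi>\<bar> \<le> \<delta>) \<longrightarrow> \<bar>integral\<^sup>L \<mu> f - integral\<^sup>L \<nu> f\<bar> \<le> e)"
    if f: "continuous_on UNIV f" and "0 < e" for f :: "'x \<Rightarrow> real" and e :: real
  proof -
    obtain d where d: "0 < d" "\<And>x y. dist x y < d \<Longrightarrow> dist (f x) (f y) < e / 3"
      using compact_uniformly_continuous[OF f K] \<open>0 < e\<close>
      unfolding uniformly_continuous_on_def by (metis UNIV_I divide_pos_pos zero_less_numeral)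
    obtain n where "inverse (of_nat (Suc n)) < d" using reals_Archimedean[OF d(1)] by blast
    then have n: "1 / (real n + 1) < d" by (simp add: inverse_eq_divide add.commute)
    \<comment> \<open>Total size of the coefficients in \<open>g\<close>. The tolerance
      \<open>e / (3 * (c + 1))\<close> for the test functions makes their contribution at most
      \<open>e / 3\<close>, also when \<open>c = 0\<close>.\<close>
    define c where "c = (\<Sum>x\<in>S n. \<bar>f x\<bar>)"
    have "0 \<le> c" by (simp add: c_def sum_nonneg)
    \<comment> \<open>Average of the values of f at the net points, weighted by the partition of
      unity. Only net points within d of y contribute at y, so \<open>g\<close> stays within
      \<open>e / 3\<close> of f; replacing f by \<open>g\<close> under both measures uses the other
      two thirds of \<open>e\<close>.\<close>
    define g where "g y = (\<Sum>x\<in>S n. f x * \<phi> n x y)" for y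
    have g: "continuous_on UNIV g"
      unfolding g_def using cont by (intro continuous_intros) auto
    have fg: "\<bar>f y - g y\<bar> \<le> e / 3" for y
    proof -
      have "f y - g y = (\<Sum>x\<in>S n. (f y - f x) * \<phi> n x y)"
        by (simp add: g_def left_diff_distrib sum_subtractf one flip: sum_distrib_left)
      also have "\<bar>\<dots>\<bar> \<le> (\<Sum>x\<in>S n. \<bar>(f y - f x) * \<phi> n x y\<bar>)" by (rule sum_abs)
      also have "\<dots> \<le> (\<Sum>x\<in>S n. e / 3 * \<phi> n x y)"
      proof (rule sum_mono)
        fix x
        show "\<bar>(f y - f x) * \<phi> n x y\<bar> \<le> e / 3 * \<phi> n x y"
        proof (cases "\<phi> n x y = 0")
          case False
          then have "dist (f x) (f y) < e / 3" using small n by (intro d(2)) (meson less_trans)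
          then have "\<bar>f y - f x\<bar> \<le> e / 3" by (simp add: dist_real_def abs_minus_commute)
          then show ?thesis
            using nonneg[of n x y] unfolding abs_mult by (simp only: abs_of_nonneg mult_right_mono)
        qed simp
      qed
      also have "\<dots> = e / 3" by (simp only: one mult_1_right flip: sum_distrib_left)
      finally show ?thesis .
    qed
    have int_fg: "\<bar>integral\<^sup>L \<mu> f - integral\<^sup>L \<mu> g\<bar> \<le> e / 3"
      if \<mu>: "prob_space \<mu>" "sets \<mu> = sets borel" for \<mu>
    proof -
      have int: "integrable \<mu> f" "integrable \<mu> g"
        using integrable_continuous_compact_space[OF K _ \<mu>] f g by auto
      then have "\<bar>integral\<^sup>L \<mu> f - integral\<^sup>L \<mu> g\<bar> \<le> (\<integral>y. \<bar>f y - g y\<bar> \<partial>\<mu>)"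
        using integral_abs_bound[of \<mu> "\<lambda>y. f y - g y"] by simp
      also have "\<dots> \<le> e / 3"
        using int fg by (intro prob_space.integral_le_const \<mu>(1)) auto
      finally show ?thesis .
    qed
    have int_g: "integral\<^sup>L \<mu> g = (\<Sum>x\<in>S n. f x * integral\<^sup>L \<mu> (\<phi> n x))"
      if "prob_space \<mu>" "sets \<mu> = sets borel" for \<mu>
      unfolding g_def using integrable_continuous_compact_space[OF K cont that] by simp
    have "\<bar>integral\<^sup>L \<mu> f - integral\<^sup>L \<nu> f\<bar> \<le> e"
      if \<mu>: "prob_space \<mu>" "sets \<mu> = sets borel" and \<nu>: "prob_space \<nu>" "sets \<nu> = sets borel"
        and close: "\<And>\<psi>. \<psi> \<in> \<phi> n ` S n \<Longrightarrow> \<bar>integral\<^sup>L \<mu> \<psi> - integral\<^sup>L \<nu> \<psi>\<bar> \<le> e / (3 * (c + 1))" for \<mu> \<nu>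
    proof -
      have "integral\<^sup>L \<mu> g - integral\<^sup>L \<nu> g
          = (\<Sum>x\<in>S n. f x * (integral\<^sup>L \<mu> (\<phi> n x) - integral\<^sup>L \<nu> (\<phi> n x)))"
        using \<mu> \<nu> by (simp add: int_g right_diff_distrib sum_subtractf)
      also have "\<bar>\<dots>\<bar> \<le> (\<Sum>x\<in>S n. \<bar>f x * (integral\<^sup>L \<mu> (\<phi> n x) - integral\<^sup>L \<nu> (\<phi> n x))\<bar>)"
        by (rule sum_abs)
      also have "\<dots> \<le> (\<Sum>x\<in>S n. \<bar>f x\<bar> * (e / (3 * (c + 1))))"
        unfolding abs_mult using close by (intro sum_mono mult_left_mono) auto
      also have "\<dots> = c * (e / (3 * (c + 1)))" by (simp only: c_def sum_distrib_right)
      also have "\<dots> \<le> e / 3" using \<open>0 \<le> c\<close> \<open>0 < e\<close> by (simp add: field_simps)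
      finally show ?thesis using int_fg[OF \<mu>] int_fg[OF \<nu>] by linarith
    qed
    moreover have "0 < e / (3 * (c + 1))" using \<open>0 \<le> c\<close> \<open>0 < e\<close> by simp
    ultimately show ?thesis
      by (intro exI[of _ n] exI[of _ "e / (3 * (c + 1))"]) blast
  qed
  note close = this
  show ?thesis
  proof (intro exI[of _ "\<lambda>n. \<phi> n ` S n"] conjI allI impI ballI)
    show "finite (\<phi> n ` S n)" for n using S by simp
    show "continuous_on UNIV \<psi>" if "\<psi> \<in> \<phi> n ` S n" for n \<psi> using cont that by blast
  qed (rule close)
qed

section \<open>Approximation by ergodic mixtures at small scales\<close>

text \<open>The point \<open>((\<integral>\<phi> d\<mu>0)\<^sub>\<phi>, b)\<close> is approximated inside the convex set \<open>C\<close> of pairs of integrals and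
  lower entropy bounds realised by finite ergodic mixtures at all small scales. The cap
  \<open>t \<le> M\<close> in \<open>C\<close> makes the penalised functional bounded above and costs nothing, since
  \<open>M\<close> dominates every \<open>mdim_meas T F \<mu>\<close>.\<close>

lemma coE_approximation:
  fixes T :: "'g::group_add \<Rightarrow> 'x::metric_space \<Rightarrow> 'x" and \<Phi> :: "('x \<Rightarrow> real) set"
  assumes count: "countable (UNIV :: 'g set)" and K: "compact (UNIV :: 'x set)" and act: "is_action T"
    and fin_top: "mdim_top T F (\<lambda>_. 0) < \<infinity>"
    and attained: "\<And>f :: 'x \<Rightarrow> real. continuous_on UNIV f \<Longrightarrow>
      \<exists>\<mu>\<in>invariant_measures T. mdim_top T F f = mdim_meas T F \<mu> + ereal (integral\<^sup>L \<mu> f)"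
    and bound: "\<And>\<mu>. \<mu> \<in> invariant_measures T \<Longrightarrow> mdim_meas T F \<mu> \<le> mdim_top T F (\<lambda>_. 0)"
    and \<mu>0: "prob_space \<mu>0" "sets \<mu>0 = sets borel"
    and b: "\<And>f :: 'x \<Rightarrow> real. continuous_on UNIV f \<Longrightarrow> ereal b < mdim_top T F f - ereal (integral\<^sup>L \<mu>0 f)"
    and \<Phi>: "finite \<Phi>" "\<And>\<phi>. \<phi> \<in> \<Phi> \<Longrightarrow> continuous_on UNIV \<phi>" and "0 < \<delta>"
  shows "\<forall>\<^sub>F \<epsilon> in at_right 0. \<exists>\<mu>\<in>coE T.
    (\<forall>\<phi>\<in>\<Phi>. \<bar>integral\<^sup>L \<mu> \<phi> - integral\<^sup>L \<mu>0 \<phi>\<bar> \<le> \<delta>) \<and> b - \<delta> \<le> Fmix T F \<mu> \<epsilon> / ln (1 / \<epsilon>)"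
proof -
  \<comment> \<open>The cap is a real number: \<open>fin_top\<close> excludes the value plus
    infinity, and hypothesis \<open>b\<close> for the zero function excludes minus infinity.\<close>
  obtain M where M: "mdim_top T F (\<lambda>_. 0) = ereal M"
    using fin_top b[of "\<lambda>_. 0"] by (cases "mdim_top T F (\<lambda>_. 0)") auto
  have "\<exists>B. \<forall>x. \<bar>\<phi> x\<bar> \<le> B" if "\<phi> \<in> \<Phi>" for \<phi>
    using continuous_bounded_on_compact_space[OF K \<Phi>(2)[OF that]] .
  then obtain B where B: "\<And>\<phi> x. \<phi> \<in> \<Phi> \<Longrightarrow> \<bar>\<phi> x\<bar> \<le> B \<phi>" by metis
  have meas: "\<phi> \<in> borel_measurable borel" if "\<phi> \<in> \<Phi>" for \<phi>
    using borel_measurable_continuous_onI[OF \<Phi>(2)[OF that]] .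
  define near where "near v t d \<epsilon> \<mu> \<longleftrightarrow> \<mu> \<in> coE T \<and> (\<forall>\<phi>\<in>\<Phi>. \<bar>integral\<^sup>L \<mu> \<phi> - v \<phi>\<bar> \<le> d) \<and>
    t - d \<le> Fmix T F \<mu> \<epsilon> / ln (1 / \<epsilon>)" for v t d \<epsilon> \<mu>
  \<comment> \<open>The realising measure may depend on both \<epsilon> and \<open>d\<close> and is
    required only for small \<epsilon>. Two points of \<open>C\<close> can thus be mixed scale by
    scale without enlarging the tolerance.\<close>
  define C where "C v t \<longleftrightarrow> t \<le> M \<and> (\<forall>d>0. \<forall>\<^sub>F \<epsilon> in at_right 0. \<exists>\<mu>. near v t d \<epsilon> \<mu>)" for v t
  \<comment> \<open>Half of \<delta> is spent on approximating the target point inside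
    \<open>C\<close>, the other half on realising the point found there by a measure. The summand 1
    in the coordinate bound comes from realising a point of \<open>C\<close> with tolerance
    1.\<close>
  have "\<exists>v t. C v t \<and> b - \<delta> / 2 \<le> t \<and> (\<forall>\<phi>\<in>\<Phi>. \<bar>v \<phi> - integral\<^sup>L \<mu>0 \<phi>\<bar> \<le> \<delta> / 2)"
  proof (rule penalised_maximisation[where K = M and B = "\<lambda>\<phi>. B \<phi> + 1"])
    show "finite \<Phi>" by fact
    show "0 < \<delta> / 2" using \<open>0 < \<delta>\<close> by simp
    show "t \<le> M" if "C v t" for v t using that by (simp add: C_def)
    show "\<bar>v \<phi>\<bar> \<le> B \<phi> + 1" if "C v t" "\<phi> \<in> \<Phi>" for v t \<phi>
    proof -
      have "\<forall>\<^sub>F \<epsilon> in at_right (0::real). \<exists>\<mu>. near v t 1 \<epsilon> \<mu>"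
        using that by (simp add: C_def)
      then obtain \<epsilon> \<mu> where near: "near v t 1 \<epsilon> \<mu>"
        using eventually_happens'[OF trivial_limit_at_right_real[of 0]] by blast
      then have \<mu>: "prob_space \<mu>" "sets \<mu> = sets borel" and 1: "\<bar>integral\<^sup>L \<mu> \<phi> - v \<phi>\<bar> \<le> 1"
        using that(2) coED[of \<mu> T] by (simp_all add: near_def)
      have int: "integrable \<mu> \<phi>"
        using integrable_continuous_compact_space[OF K \<Phi>(2)[OF that(2)] \<mu>] .
      then have "\<bar>integral\<^sup>L \<mu> \<phi>\<bar> \<le> (\<integral>x. \<bar>\<phi> x\<bar> \<partial>\<mu>)" by (intro integral_abs_bound)
      also have "\<dots> \<le> B \<phi>"
        using int B[OF that(2)] by (intro prob_space.integral_le_const \<mu>(1)) auto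
      finally show ?thesis using 1 by linarith
    qed
    show "C (\<lambda>\<phi>. (1 - s) * v \<phi> + s * v' \<phi>) ((1 - s) * t + s * t')"
      if c: "C v t" and c': "C v' t'" and s: "0 \<le> s" "s \<le> 1" for v t v' t' s
      unfolding C_def
    proof (intro conjI allI impI)
      have "(1 - s) * t + s * t' \<le> (1 - s) * M + s * M"
        using c c' s by (intro add_mono mult_left_mono) (auto simp: C_def)
      then show "(1 - s) * t + s * t' \<le> M" by (simp add: algebra_simps)
      fix d :: real assume "0 < d"
      then have "\<forall>\<^sub>F \<epsilon> in at_right 0. \<exists>\<mu>. near v t d \<epsilon> \<mu>" "\<forall>\<^sub>F \<epsilon> in at_right 0. \<exists>\<mu>. near v' t' d \<epsilon> \<mu>"
        using c c' by (auto simp: C_def)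
      then show "\<forall>\<^sub>F \<epsilon> in at_right 0. \<exists>\<mu>.
          near (\<lambda>\<phi>. (1 - s) * v \<phi> + s * v' \<phi>) ((1 - s) * t + s * t') d \<epsilon> \<mu>"
      proof eventually_elim
        case (elim \<epsilon>)
        then obtain \<mu> \<mu>' where near: "near v t d \<epsilon> \<mu>" and near': "near v' t' d \<epsilon> \<mu>'" by blast
        obtain \<rho> where \<rho>: "\<rho> \<in> coE T"
          "Fmix T F \<rho> \<epsilon> = (1 - s) * Fmix T F \<mu> \<epsilon> + s * Fmix T F \<mu>' \<epsilon>"
          "\<And>f::'x \<Rightarrow> real. f \<in> borel_measurable borel \<Longrightarrow> \<exists>B. \<forall>x. \<bar>f x\<bar> \<le> B \<Longrightarrow>
             integral\<^sup>L \<rho> f = (1 - s) * integral\<^sup>L \<mu> f + s * integral\<^sup>L \<mu>' f"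
          using coE_convex[OF count act, of \<mu> \<mu>' s F \<epsilon>] near near' s unfolding near_def by blast
        have "\<bar>integral\<^sup>L \<rho> \<phi> - ((1 - s) * v \<phi> + s * v' \<phi>)\<bar> \<le> d" if "\<phi> \<in> \<Phi>" for \<phi>
        proof -
          have "integral\<^sup>L \<rho> \<phi> - ((1 - s) * v \<phi> + s * v' \<phi>)
              = (1 - s) * (integral\<^sup>L \<mu> \<phi> - v \<phi>) + s * (integral\<^sup>L \<mu>' \<phi> - v' \<phi>)"
            using \<rho>(3)[OF meas[OF that]] B[OF that] by (simp add: algebra_simps) blast
          also have "\<bar>\<dots>\<bar> \<le> (1 - s) * \<bar>integral\<^sup>L \<mu> \<phi> - v \<phi>\<bar> + s * \<bar>integral\<^sup>L \<mu>' \<phi> - v' \<phi>\<bar>"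
            using s by (intro order_trans[OF abs_triangle_ineq]) (simp add: abs_mult)
          also have "\<dots> \<le> (1 - s) * d + s * d"
            using near near' s that by (intro add_mono mult_left_mono) (auto simp: near_def)
          finally show ?thesis by (simp add: algebra_simps)
        qed
        moreover have "(1 - s) * t + s * t' - d \<le> Fmix T F \<rho> \<epsilon> / ln (1 / \<epsilon>)"
        proof -
          have "(1 - s) * t + s * t' - d = (1 - s) * (t - d) + s * (t' - d)"
            by (simp add: algebra_simps)
          also have "\<dots> \<le> (1 - s) * (Fmix T F \<mu> \<epsilon> / ln (1 / \<epsilon>)) + s * (Fmix T F \<mu>' \<epsilon> / ln (1 / \<epsilon>))"
            using near near' s by (intro add_mono mult_left_mono) (auto simp: near_def)
          also have "\<dots> = Fmix T F \<rho> \<epsilon> / ln (1 / \<epsilon>)"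
            unfolding \<rho>(2) by (simp only: add_divide_distrib times_divide_eq_right)
          finally show ?thesis .
        qed
        ultimately show ?case using \<rho>(1) by (auto simp: near_def)
      qed
    qed
    show "\<exists>v t. C v t \<and> b < t + (\<Sum>\<phi>\<in>\<Phi>. a \<phi> * (v \<phi> - integral\<^sup>L \<mu>0 \<phi>))" for a
    proof -
      \<comment> \<open>The coefficients of the functional become a continuous potential. At a
        measure \<mu> attaining the variational principle for \<open>f\<close>, hypothesis
        \<open>b\<close> turns into the strict inequality required of a point of
        \<open>C\<close>.\<close>
      define f where "f x = (\<Sum>\<phi>\<in>\<Phi>. a \<phi> * \<phi> x)" for x
      have f: "continuous_on UNIV f"
        unfolding f_def using \<Phi>(2) by (intro continuous_intros) auto
      obtain \<mu> where \<mu>: "\<mu> \<in> invariant_measures T"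
        and max: "mdim_top T F f = mdim_meas T F \<mu> + ereal (integral\<^sup>L \<mu> f)"
        using attained[OF f] by blast
      have prob: "prob_space \<mu>" "sets \<mu> = sets borel"
        using \<mu> by (auto simp: invariant_measures_def)
      have int_f: "integral\<^sup>L \<nu> f = (\<Sum>\<phi>\<in>\<Phi>. a \<phi> * integral\<^sup>L \<nu> \<phi>)"
        if "prob_space \<nu>" "sets \<nu> = sets borel" for \<nu>
        unfolding f_def using integrable_continuous_compact_space[OF K \<Phi>(2) that] by simp
      have "ereal (b - integral\<^sup>L \<mu> f + integral\<^sup>L \<mu>0 f) < mdim_meas T F \<mu>"
        using b[OF f] max by (cases "mdim_meas T F \<mu>") auto
      \<comment> \<open>The supremum defining \<open>mdim_meas T F \<mu>\<close> need not be
        attained. A real t strictly below it is exceeded, at all small scales, by the normalised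
        entropy along some family in \<open>MG T \<mu>\<close>.\<close>
      from ereal_dense2[OF this] obtain t where t: "b - integral\<^sup>L \<mu> f + integral\<^sup>L \<mu>0 f < t" "ereal t < mdim_meas T F \<mu>"
        by auto
      obtain \<mu>s where \<mu>s: "\<mu>s \<in> MG T \<mu>"
        and "ereal t < Liminf (at_right 0) (\<lambda>\<epsilon>. ereal (Fmix T F (\<mu>s \<epsilon>) \<epsilon> / ln (1 / \<epsilon>)))"
        using t(2) unfolding mdim_meas_def less_SUP_iff by blast
      then have ev_t: "\<forall>\<^sub>F \<epsilon> in at_right 0. t < Fmix T F (\<mu>s \<epsilon>) \<epsilon> / ln (1 / \<epsilon>)"
        using less_LiminfD by fastforce
      have "C (\<lambda>\<phi>. integral\<^sup>L \<mu> \<phi>) t"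
        unfolding C_def
      proof (intro conjI allI impI)
        have "ereal t < ereal M" using less_le_trans[OF t(2) bound[OF \<mu>]] by (simp only: M)
        then show "t \<le> M" by simp
        fix d :: real assume "0 < d"
        have "\<forall>\<phi>\<in>\<Phi>. \<forall>\<^sub>F \<epsilon> in at_right 0. dist (integral\<^sup>L (\<mu>s \<epsilon>) \<phi>) (integral\<^sup>L \<mu> \<phi>) < d"
          using \<mu>s \<Phi>(2) \<open>0 < d\<close> by (auto simp: MG_def intro: tendstoD)
        then have "\<forall>\<^sub>F \<epsilon> in at_right 0. \<forall>\<phi>\<in>\<Phi>. dist (integral\<^sup>L (\<mu>s \<epsilon>) \<phi>) (integral\<^sup>L \<mu> \<phi>) < d"
          using \<Phi>(1) by (simp add: eventually_ball_finite)
        moreover have "\<forall>\<^sub>F \<epsilon> in at_right 0. (0::real) < \<epsilon>" by (rule eventually_at_right_less)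
        ultimately show "\<forall>\<^sub>F \<epsilon> in at_right 0. \<exists>\<nu>. near (\<lambda>\<phi>. integral\<^sup>L \<mu> \<phi>) t d \<epsilon> \<nu>"
          using ev_t
        proof eventually_elim
          case (elim \<epsilon>)
          have "near (\<lambda>\<phi>. integral\<^sup>L \<mu> \<phi>) t d \<epsilon> (\<mu>s \<epsilon>)"
            unfolding near_def using elim \<mu>s \<open>0 < d\<close> by (auto simp: MG_def dist_real_def less_imp_le)
          then show ?case by blast
        qed
      qed
      moreover have "(\<Sum>\<phi>\<in>\<Phi>. a \<phi> * (integral\<^sup>L \<mu> \<phi> - integral\<^sup>L \<mu>0 \<phi>)) = integral\<^sup>L \<mu> f - integral\<^sup>L \<mu>0 f"
        using int_f[OF prob] int_f[OF \<mu>0] by (simp add: right_diff_distrib sum_subtractf)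
      ultimately show ?thesis using t(1)
        by (intro exI[of _ "\<lambda>\<phi>. integral\<^sup>L \<mu> \<phi>"] exI[of _ t]) simp
    qed
  qed
  then obtain v t where c: "C v t" and t: "b - \<delta> / 2 \<le> t"
    and v: "\<And>\<phi>. \<phi> \<in> \<Phi> \<Longrightarrow> \<bar>v \<phi> - integral\<^sup>L \<mu>0 \<phi>\<bar> \<le> \<delta> / 2" by blast
  have "\<forall>\<^sub>F \<epsilon> in at_right 0. \<exists>\<mu>. near v t (\<delta> / 2) \<epsilon> \<mu>"
    using c \<open>0 < \<delta>\<close> by (simp add: C_def)
  then show ?thesis
  proof eventually_elim
    case (elim \<epsilon>)
    then obtain \<mu> where \<mu>: "near v t (\<delta> / 2) \<epsilon> \<mu>" by blast
    have "\<bar>integral\<^sup>L \<mu> \<phi> - integral\<^sup>L \<mu>0 \<phi>\<bar> \<le> \<delta>" if "\<phi> \<in> \<Phi>" for \<phi>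
    proof -
      have "\<bar>integral\<^sup>L \<mu> \<phi> - v \<phi>\<bar> \<le> \<delta> / 2" using \<mu> that by (simp add: near_def)
      then show ?thesis using v[OF that] by linarith
    qed
    moreover have "\<mu> \<in> coE T" "t - \<delta> / 2 \<le> Fmix T F \<mu> \<epsilon> / ln (1 / \<epsilon>)"
      using \<mu> by (auto simp: near_def)
    ultimately show ?case using t by (intro bexI[of _ \<mu>] conjI) auto
  qed
qed

section \<open>The dual formula for the measure-theoretic mean dimension\<close>

theorem theorem3p35:
  fixes T :: "'g::group_add \<Rightarrow> 'x::metric_space \<Rightarrow> 'x" and F :: "nat \<Rightarrow> 'g set"
    and \<mu>0 :: "'x measure"
  assumes "countable (UNIV :: 'g set)" and "infinite (UNIV :: 'g set)"
    and "compact (UNIV :: 'x set)"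
    and "is_action T"
    and "tempered F"
    and "mdim_top T F (\<lambda>_. 0) < \<infinity>"
    and "\<forall>f::'x \<Rightarrow> real. continuous_on UNIV f \<longrightarrow>
           (\<exists>\<mu>\<in>invariant_measures T. mdim_top T F f = mdim_meas T F \<mu> + ereal (integral\<^sup>L \<mu> f)) \<and>
           (\<forall>\<mu>\<in>invariant_measures T. mdim_meas T F \<mu> + ereal (integral\<^sup>L \<mu> f) \<le> mdim_top T F f)"
    and "\<mu>0 \<in> invariant_measures T"
  shows "mdim_meas T F \<mu>0 =
           (INF f\<in>{f::'x \<Rightarrow> real. continuous_on UNIV f}. mdim_top T F f - ereal (integral\<^sup>L \<mu>0 f))"
proof (rule antisym)
  note K = assms(3)
  have \<mu>0: "prob_space \<mu>0" "sets \<mu>0 = sets borel"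
    using assms(8) by (auto simp: invariant_measures_def)
  show "mdim_meas T F \<mu>0 \<le> (INF f\<in>{f::'x \<Rightarrow> real. continuous_on UNIV f}. mdim_top T F f - ereal (integral\<^sup>L \<mu>0 f))"
  proof (rule INF_greatest)
    fix f :: "'x \<Rightarrow> real" assume "f \<in> {f. continuous_on UNIV f}"
    then have "mdim_meas T F \<mu>0 + ereal (integral\<^sup>L \<mu>0 f) \<le> mdim_top T F f"
      using assms(7,8) by blast
    then show "mdim_meas T F \<mu>0 \<le> mdim_top T F f - ereal (integral\<^sup>L \<mu>0 f)"
      by (simp add: ereal_le_minus)
  qed
  show "(INF f\<in>{f::'x \<Rightarrow> real. continuous_on UNIV f}. mdim_top T F f - ereal (integral\<^sup>L \<mu>0 f)) \<le> mdim_meas T F \<mu>0"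
  proof (rule ccontr)
    assume "\<not> ?thesis"
    then have "mdim_meas T F \<mu>0 <
        (INF f\<in>{f::'x \<Rightarrow> real. continuous_on UNIV f}. mdim_top T F f - ereal (integral\<^sup>L \<mu>0 f))"
      by (simp only: not_le)
    then obtain b where b: "mdim_meas T F \<mu>0 < ereal b"
      and "ereal b < (INF f\<in>{f::'x \<Rightarrow> real. continuous_on UNIV f}. mdim_top T F f - ereal (integral\<^sup>L \<mu>0 f))"
      using ereal_dense2 by blast
    then have b': "ereal b < mdim_top T F f - ereal (integral\<^sup>L \<mu>0 f)" if "continuous_on UNIV f" for f :: "'x \<Rightarrow> real"
      using that by (blast intro: less_le_trans INF_lower)
    obtain \<Phi> :: "nat \<Rightarrow> ('x \<Rightarrow> real) set" where \<Phi>: "\<And>n. finite (\<Phi> n)"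
        "\<And>n \<phi>. \<phi> \<in> \<Phi> n \<Longrightarrow> continuous_on UNIV \<phi>"
      and test: "\<And>(f :: 'x \<Rightarrow> real) e. continuous_on UNIV f \<Longrightarrow> 0 < e \<Longrightarrow> \<exists>n \<delta>. 0 < \<delta> \<and>
        (\<forall>\<mu> \<nu>. prob_space \<mu> \<longrightarrow> sets \<mu> = sets borel \<longrightarrow> prob_space \<nu> \<longrightarrow> sets \<nu> = sets borel \<longrightarrow>
          (\<forall>\<phi>\<in>\<Phi> n. \<bar>integral\<^sup>L \<mu> \<phi> - integral\<^sup>L \<nu> \<phi>\<bar> \<le> \<delta>) \<longrightarrow> \<bar>integral\<^sup>L \<mu> f - integral\<^sup>L \<nu> f\<bar> \<le> e)"
      using weak_topology_test_functions[OF K] by blast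
    \<comment> \<open>The union over \<open>k \<le> n\<close> and the shrinking tolerance make
      \<open>P\<close> stronger as n grows, which diagonal selection requires.\<close>
    define P where "P n \<epsilon> \<mu> \<longleftrightarrow> \<mu> \<in> coE T \<and>
      (\<forall>\<phi>\<in>(\<Union>k\<le>n. \<Phi> k). \<bar>integral\<^sup>L \<mu> \<phi> - integral\<^sup>L \<mu>0 \<phi>\<bar> \<le> 1 / (real n + 1)) \<and>
      b - 1 / (real n + 1) \<le> Fmix T F \<mu> \<epsilon> / ln (1 / \<epsilon>)" for n \<epsilon> \<mu>
    have "\<exists>\<mu>s. \<forall>n. \<forall>\<^sub>F \<epsilon> in at_right 0. P n \<epsilon> (\<mu>s \<epsilon>)"
    proof (rule diagonal_selection_at_right)
      fix n k \<epsilon> \<mu> assume P: "P n \<epsilon> \<mu>" and "k \<le> n"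
      then have le: "1 / (real n + 1) \<le> 1 / (real k + 1)" by (simp add: field_simps)
      have "(\<Union>j\<le>k. \<Phi> j) \<subseteq> (\<Union>j\<le>n. \<Phi> j)" using \<open>k \<le> n\<close> by force
      then show "P k \<epsilon> \<mu>"
        using P le unfolding P_def by (meson diff_left_mono order_trans subsetD)
    next
      fix n
      have "\<forall>\<^sub>F \<epsilon> in at_right 0. \<exists>\<mu>\<in>coE T.
         (\<forall>\<phi>\<in>(\<Union>k\<le>n. \<Phi> k). \<bar>integral\<^sup>L \<mu> \<phi> - integral\<^sup>L \<mu>0 \<phi>\<bar> \<le> 1 / (real n + 1)) \<and>
         b - 1 / (real n + 1) \<le> Fmix T F \<mu> \<epsilon> / ln (1 / \<epsilon>)"
      proof (rule coE_approximation[OF assms(1) K assms(4,6) _ _ \<mu>0 b'])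
        show "\<exists>\<mu>\<in>invariant_measures T. mdim_top T F f = mdim_meas T F \<mu> + ereal (integral\<^sup>L \<mu> f)"
          if "continuous_on UNIV f" for f :: "'x \<Rightarrow> real"
          using assms(7) that by blast
        show "mdim_meas T F \<mu> \<le> mdim_top T F (\<lambda>_. 0)" if "\<mu> \<in> invariant_measures T" for \<mu>
          using assms(7)[rule_format, of "\<lambda>_. 0"] that by (auto simp: zero_ereal_def[symmetric])
      qed (use \<Phi> in auto)
      then show "\<forall>\<^sub>F \<epsilon> in at_right 0. \<exists>\<mu>. P n \<epsilon> \<mu>"
        by (rule eventually_mono) (auto simp: P_def)
    qed
    then obtain \<mu>s where \<mu>s: "\<And>n. \<forall>\<^sub>F \<epsilon> in at_right 0. P n \<epsilon> (\<mu>s \<epsilon>)" by blast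
    obtain \<mu>1 where \<mu>1: "\<mu>1 \<in> coE T"
      using eventually_happens'[OF trivial_limit_at_right_real \<mu>s[of 0]] by (auto simp: P_def)
    \<comment> \<open>Diagonal selection controls only small scales, whereas \<open>MG\<close>
      demands a member of \<open>coE T\<close> at every positive scale. A fixed member fills the
      remaining scales without affecting limits.\<close>
    define \<nu>s where "\<nu>s \<epsilon> = (if \<mu>s \<epsilon> \<in> coE T then \<mu>s \<epsilon> else \<mu>1)" for \<epsilon>
    have \<nu>s: "\<forall>\<^sub>F \<epsilon> in at_right 0. P n \<epsilon> (\<nu>s \<epsilon>)" for n
      using \<mu>s[of n] by (rule eventually_mono) (auto simp: \<nu>s_def P_def)
    have ev_n: "\<exists>n. 1 / (real n + 1) \<le> e \<and> m \<le> n" if e: "0 < e" for e m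
    proof -
      obtain n where "inverse (real (Suc n)) < e" using reals_Archimedean[OF e] by blast
      moreover have "1 / (real (max m n) + 1) \<le> 1 / (real n + 1)" by (simp add: field_simps)
      moreover have "inverse (real (Suc n)) = 1 / (real n + 1)" by (simp add: inverse_eq_divide add.commute)
      ultimately have "1 / (real (max m n) + 1) \<le> e" by linarith
      then show ?thesis using max.cobounded1 by blast
    qed
    have "\<nu>s \<in> MG T \<mu>0"
      unfolding MG_def
    proof (intro CollectI conjI allI impI tendstoI)
      show "\<nu>s \<epsilon> \<in> coE T" for \<epsilon> using \<mu>1 by (simp add: \<nu>s_def)
      fix f :: "'x \<Rightarrow> real" and e :: real assume f: "continuous_on UNIV f" and "0 < e"
      obtain m \<delta> where "0 < \<delta>" and close:
        "\<And>\<mu> \<nu>. prob_space \<mu> \<Longrightarrow> sets \<mu> = sets borel \<Longrightarrow> prob_space \<nu> \<Longrightarrow> sets \<nu> = sets borel \<Longrightarrow>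
          (\<And>\<phi>. \<phi> \<in> \<Phi> m \<Longrightarrow> \<bar>integral\<^sup>L \<mu> \<phi> - integral\<^sup>L \<nu> \<phi>\<bar> \<le> \<delta>) \<Longrightarrow>
          \<bar>integral\<^sup>L \<mu> f - integral\<^sup>L \<nu> f\<bar> \<le> e / 2"
        using test[OF f, of "e / 2"] \<open>0 < e\<close> by (metis half_gt_zero)
      \<comment> \<open>The index is past m, so that the functions in \<open>\<Phi> m\<close> are
        among those controlled, and large enough for the tolerance to drop below \<delta>.\<close>
      obtain n where n: "1 / (real n + 1) \<le> \<delta>" "m \<le> n" using ev_n[OF \<open>0 < \<delta>\<close>] by blast
      show "\<forall>\<^sub>F \<epsilon> in at_right 0. dist (integral\<^sup>L (\<nu>s \<epsilon>) f) (integral\<^sup>L \<mu>0 f) < e"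
        using \<nu>s[of n]
      proof eventually_elim
        case (elim \<epsilon>)
        have "\<bar>integral\<^sup>L (\<nu>s \<epsilon>) f - integral\<^sup>L \<mu>0 f\<bar> \<le> e / 2"
        proof (rule close[OF _ _ \<mu>0])
          show "prob_space (\<nu>s \<epsilon>)" "sets (\<nu>s \<epsilon>) = sets borel"
            using coED[of "\<nu>s \<epsilon>" T] elim by (simp_all add: P_def)
          fix \<phi> assume "\<phi> \<in> \<Phi> m"
          then have "\<phi> \<in> (\<Union>k\<le>n. \<Phi> k)" using n(2) by blast
          then have "\<bar>integral\<^sup>L (\<nu>s \<epsilon>) \<phi> - integral\<^sup>L \<mu>0 \<phi>\<bar> \<le> 1 / (real n + 1)"
            using elim unfolding P_def by blast
          then show "\<bar>integral\<^sup>L (\<nu>s \<epsilon>) \<phi> - integral\<^sup>L \<mu>0 \<phi>\<bar> \<le> \<delta>" using n(1) by linarith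
        qed
        then show ?case using \<open>0 < e\<close> by (simp add: dist_real_def)
      qed
    qed
    moreover have "ereal b \<le> Liminf (at_right 0) (\<lambda>\<epsilon>. ereal (Fmix T F (\<nu>s \<epsilon>) \<epsilon> / ln (1 / \<epsilon>)))"
      unfolding le_Liminf_iff
    proof (intro allI impI)
      \<comment> \<open>A fixed index n yields only the bound \<open>b - 1 / (real n + 1)\<close>,
        and only for small scales; \<open>b\<close> is therefore reached through all smaller
        values.\<close>
      fix y assume "y < ereal b"
      from ereal_dense2[OF this] obtain r where r: "y < ereal r" "r < b" by auto
      have "0 < b - r" using r(2) by simp
      then obtain n where n: "1 / (real n + 1) \<le> b - r" using ev_n by blast
      show "\<forall>\<^sub>F \<epsilon> in at_right 0. y < ereal (Fmix T F (\<nu>s \<epsilon>) \<epsilon> / ln (1 / \<epsilon>))"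
        using \<nu>s[of n]
      proof eventually_elim
        case (elim \<epsilon>)
        then have "r \<le> Fmix T F (\<nu>s \<epsilon>) \<epsilon> / ln (1 / \<epsilon>)" using n unfolding P_def by linarith
        then have "ereal r \<le> ereal (Fmix T F (\<nu>s \<epsilon>) \<epsilon> / ln (1 / \<epsilon>))" by simp
        with r(1) show ?case by (rule less_le_trans)
      qed
    qed
    ultimately have "ereal b \<le> mdim_meas T F \<mu>0"
      unfolding mdim_meas_def by (rule SUP_upper2[where i = \<nu>s])
    with b show False by simp
  qed
qed

end
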